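(* Let $\Omega$ be a real $d\times d$ skew-symmetric matrix ($\Omega^T=-\Omega$), and let $F:\mathbb{R}^d\times\mathbb{R}\to\mathbb{R}^d$ be bounded and continuous, with bounded continuous derivative in its first argument, and quasiperiodic in $t$: there are constants $\nu_1,\dots,\nu_n$ and a function $\hat F$, $1$-periodic in each of its last $n$ arguments, with $F(x,t)=\hat F(x,\nu_1t,\dots,\nu_nt)$. For $x\in\mathbb{R}^d$ define $$C(x):=\langle F(e^{\Omega t}x,t)\rangle_t,\qquad P(x):=\widehat{\Omega^{-1}}\,C(x),$$ $$\mathcal{F}(x,t):=e^{-\Omega t}F(e^{\Omega t}x,t),\qquad \bar{\mathcal F}(x):=\langle \mathcal F(x,t)\rangle_t,$$ $$\mathcal{G}(x,t):=e^{-\Omega t}\big(F(e^{\Omega t}x,t)-\Omega P(x)\big),\qquad \bar{\mathcal G}(x):=\langle \mathcal G(x,t)\rangle_t,$$ and $\Delta\mathcal F(x,t):=\mathcal F(x,t)-\bar{\mathcal F}(x)$, $\Delta\mathcal G(x,t):=\mathcal G(x,t)-\bar{\mathcal G}(x)$. Then for every $x\in\mathbb{R}^d$, $$\big((\Delta\mathcal F-\Delta\mathcal G)\cdot\Delta\mathcal G\big)(x)=0,$$ and consequently $\|\Delta\mathcal F\|(x)^2=\|\Delta\mathcal G\|(x)^2+\|\Delta\mathcal F-\Delta\mathcal G\|(x)^2$, in particular $$\|\Delta\mathcal G\|(x)\le\|\Delta\mathcal F\|(x).$$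
   Context: Time average: for a function $f(x,t)$, $\langle f(x,t)\rangle_t:=\lim_{T\to\infty}\frac1T\int_0^T f(x,t)\,dt$ (these limits exist under the stated quasiperiodicity assumptions, since $e^{\Omega t}$ is quasiperiodic in $t$ with frequencies given by the absolute values of the eigenvalues of $\Omega$). The matrix $\widehat{\Omega^{-1}}$: writing $\Omega=V^{-1}\mathrm{diag}(\lambda_i)V$ (diagonalization of the skew-symmetric $\Omega$, eigenvalues $\lambda_i$ purely imaginary), $\widehat{\Omega^{-1}}:=V^{-1}\mathrm{diag}(\mu_i)V$ with $\mu_i=\lambda_i^{-1}$ if $\lambda_i\neq0$ and $\mu_i=0$ if $\lambda_i=0$; in particular $\widehat{\Omega^{-1}}=\Omega^{-1}$ when $\Omega$ is invertible. $x$-indexed inner product: for column-vector-valued functions $w_1(t,x),w_2(t,x)$, $(w_1\cdot w_2)(x):=\langle w_1(t,x)^Tw_2(t,x)\rangle_t$, and $\|w\|(x):=\sqrt{(w\cdot w)(x)}$ is the induced norm. *)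

theory Defs
  imports "HOL-Analysis.Analysis"
begin

text \<open>Matrix power and matrix exponential e^{A t} (power series).\<close>
definition mpow :: "real^'n^'n \<Rightarrow> nat \<Rightarrow> real^'n^'n" where
  "mpow A k = ((\<lambda>B. B ** A) ^^ k) (mat 1)"

definition mexp :: "real^'n^'n \<Rightarrow> real \<Rightarrow> real^'n^'n" where
  "mexp A t = (\<Sum>k. (t ^ k / fact k) *\<^sub>R mpow A k)"

text \<open>Time average  lim_{T\<to>\<infinity>} (1/T) int_0^T f(t) dt.\<close>
definition tavg :: "(real \<Rightarrow> 'a::euclidean_space) \<Rightarrow> 'a" where
  "tavg f = Lim at_top (\<lambda>T. (1 / T) *\<^sub>R integral {0..T} f)"

text \<open>Diagonal matrix.\<close>
definition diag_mat :: "('n::finite \<Rightarrow> complex) \<Rightarrow> complex^'n^'n" where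
  "diag_mat l = (\<chi> i j. if i = j then l i else 0)"

text \<open>hat(Omega^{-1}): writing Omega = V^{-1} diag(lambda_i) V (complex diagonalization),
  hat(Omega^{-1}) = V^{-1} diag(mu_i) V with mu_i = 1/lambda_i if lambda_i \<noteq> 0 and 0 otherwise.\<close>
definition omega_hat_inv :: "real^'n^'n \<Rightarrow> real^'n^'n" where
  "omega_hat_inv \<Omega> = (SOME M. \<exists>(V::complex^'n^'n) l.
      invertible V \<and>
      map_matrix complex_of_real \<Omega> = matrix_inv V ** diag_mat l ** V \<and>
      map_matrix complex_of_real M =
        matrix_inv V ** diag_mat (\<lambda>i. if l i = 0 then 0 else inverse (l i)) ** V)"

text \<open>x-indexed inner product and norm of time-dependent vector fields.\<close>
definition tinner :: "(real \<Rightarrow> real^'n) \<Rightarrow> (real \<Rightarrow> real^'n) \<Rightarrow> real" where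
  "tinner w1 w2 = tavg (\<lambda>t. w1 t \<bullet> w2 t)"

definition tnorm :: "(real \<Rightarrow> real^'n) \<Rightarrow> real" where
  "tnorm w = sqrt (tinner w w)"

text \<open>The objects of the statement, parametrized by Omega and F.\<close>
definition avgC :: "real^'n^'n \<Rightarrow> (real^'n \<Rightarrow> real \<Rightarrow> real^'n) \<Rightarrow> real^'n \<Rightarrow> real^'n" where
  "avgC \<Omega> F y = tavg (\<lambda>t. F (mexp \<Omega> t *v y) t)"

definition Pfun :: "real^'n^'n \<Rightarrow> (real^'n \<Rightarrow> real \<Rightarrow> real^'n) \<Rightarrow> real^'n \<Rightarrow> real^'n" where
  "Pfun \<Omega> F y = omega_hat_inv \<Omega> *v avgC \<Omega> F y"

definition calF :: "real^'n^'n \<Rightarrow> (real^'n \<Rightarrow> real \<Rightarrow> real^'n) \<Rightarrow> real^'n \<Rightarrow> real \<Rightarrow> real^'n" where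
  "calF \<Omega> F y t = mexp \<Omega> (- t) *v F (mexp \<Omega> t *v y) t"

definition calG :: "real^'n^'n \<Rightarrow> (real^'n \<Rightarrow> real \<Rightarrow> real^'n) \<Rightarrow> real^'n \<Rightarrow> real \<Rightarrow> real^'n" where
  "calG \<Omega> F y t = mexp \<Omega> (- t) *v (F (mexp \<Omega> t *v y) t - \<Omega> *v Pfun \<Omega> F y)"

definition DcalF :: "real^'n^'n \<Rightarrow> (real^'n \<Rightarrow> real \<Rightarrow> real^'n) \<Rightarrow> real^'n \<Rightarrow> real \<Rightarrow> real^'n" where
  "DcalF \<Omega> F y t = calF \<Omega> F y t - tavg (calF \<Omega> F y)"

definition DcalG :: "real^'n^'n \<Rightarrow> (real^'n \<Rightarrow> real \<Rightarrow> real^'n) \<Rightarrow> real^'n \<Rightarrow> real \<Rightarrow> real^'n" where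
  "DcalG \<Omega> F y t = calG \<Omega> F y t - tavg (calG \<Omega> F y)"

end

theory Submission
  imports Defs "HOL-Computational_Algebra.Fundamental_Theorem_Algebra"
begin

text \<open>In the frame rotating with \<open>e\<^sup>\<Omega>\<^sup>t\<close>, the difference \<open>\<Delta>\<F> - \<Delta>\<G>\<close> is \<open>e\<^sup>-\<^sup>\<Omega>\<^sup>t v\<close> with
  \<open>v = \<Omega> P(x)\<close>, the orthogonal projection of \<open>C(x)\<close> onto the range of \<open>\<Omega>\<close>. Its mean
  vanishes, since it has the bounded primitive \<open>-e\<^sup>-\<^sup>\<Omega>\<^sup>t P(x)\<close>. As \<open>e\<^sup>-\<^sup>\<Omega>\<^sup>t\<close> is orthogonal, the
  mean of \<open>e\<^sup>-\<^sup>\<Omega>\<^sup>t v \<bullet> \<Delta>\<G>\<close> reduces to \<open>v \<bullet> C(x) - v \<bullet> v\<close>, which vanishes because \<open>C(x) - v\<close> lies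
  in the kernel of the skew matrix \<open>\<Omega>\<close>, orthogonal to its range. The norm identity is then
  Pythagoras for the averaged inner product.

  The real work is the existence of all these means. \<open>\<Omega>\<close> is unitarily diagonalizable with imaginary
  spectrum, so \<open>e\<^sup>\<Omega>\<^sup>t\<close> is a one-parameter group of orthogonal matrices. Together with the
  frequencies of \<open>F\<close> it has relatively dense almost-returns, which makes
  \<open>t \<mapsto> (e\<^sup>\<Omega>\<^sup>t, F(e\<^sup>\<Omega>\<^sup>t x, t))\<close> Bohr almost periodic; every continuous function of it then has a
  mean.\<close>

section \<open>Unitary diagonalization of real skew-symmetric matrices\<close>

definition cinner :: "complex^'n \<Rightarrow> complex^'n \<Rightarrow> complex" where
  "cinner u w = (\<Sum>i\<in>UNIV. cnj (u$i) * w$i)"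

lemma cinner_add_right: "cinner u (v + w) = cinner u v + cinner u w"
  by (simp add: cinner_def distrib_left sum.distrib)

lemma cinner_diff_right: "cinner u (v - w) = cinner u v - cinner u w"
  by (simp add: cinner_def right_diff_distrib sum_subtractf)

lemma cinner_scale_right: "cinner u (c *s w) = c * cinner u w"
  by (simp add: cinner_def sum_distrib_left mult.left_commute)

lemma cinner_scale_left: "cinner (c *s u) w = cnj c * cinner u w"
  by (simp add: cinner_def sum_distrib_left mult.assoc)

lemma cinner_sum_right: "cinner u (sum f S) = (\<Sum>s\<in>S. cinner u (f s))"
  unfolding cinner_def sum_component sum_distrib_left by (rule sum.swap)

lemma cinner_zero_right [simp]: "cinner u 0 = 0"
  by (simp add: cinner_def)

lemma cinner_commute: "cinner w u = cnj (cinner u w)"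
  by (simp add: cinner_def mult.commute)

lemma cinner_self: "cinner u u = of_real (\<Sum>i\<in>UNIV. (cmod (u$i))\<^sup>2)"
  unfolding cinner_def of_real_sum
  by (intro sum.cong refl) (metis complex_norm_square of_real_power mult.commute)

lemma cinner_self_pos:
  assumes "u \<noteq> 0"
  shows "(\<Sum>i\<in>UNIV. (cmod (u$i))\<^sup>2) > 0"
proof -
  obtain i where "u $ i \<noteq> 0" using assms by (auto simp: vec_eq_iff)
  then show ?thesis by (intro sum_pos2[of UNIV i]) auto
qed

abbreviation cmat :: "real^'n^'m \<Rightarrow> complex^'n^'m" where
  "cmat M \<equiv> map_matrix complex_of_real M"

lemma skew_matrix_entry:
  assumes "transpose \<Omega> = - \<Omega>"
  shows "\<Omega>$j$i = - \<Omega>$i$j"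
  using arg_cong[OF assms, of "\<lambda>M. M$i$j"] by (simp add: transpose_def)

lemma cinner_skew:
  fixes \<Omega> :: "real^'n^'n"
  assumes "transpose \<Omega> = - \<Omega>"
  shows "cinner u (cmat \<Omega> *v w) = - cinner (cmat \<Omega> *v u) w"
proof -
  have "cinner (cmat \<Omega> *v u) w = (\<Sum>j\<in>UNIV. \<Sum>i\<in>UNIV. of_real (\<Omega>$j$i) * cnj (u$i) * w$j)"
    by (simp add: cinner_def matrix_vector_mult_def cnj_sum sum_distrib_right)
  also have "\<dots> = - (\<Sum>i\<in>UNIV. \<Sum>j\<in>UNIV. cnj (u$i) * (of_real (\<Omega>$i$j) * w$j))"
  proof -
    have "of_real (\<Omega>$j$i) * cnj (u$i) * w$j = - (cnj (u$i) * (of_real (\<Omega>$i$j) * w$j))" for i j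
      by (simp add: skew_matrix_entry[OF assms, of j i])
    then show ?thesis by (subst sum.swap) (simp add: sum_negf)
  qed
  also have "\<dots> = - cinner u (cmat \<Omega> *v w)"
    by (simp add: cinner_def matrix_vector_mult_def sum_distrib_left)
  finally show ?thesis by simp
qed

definition poly_apply :: "complex^'n^'n \<Rightarrow> complex poly \<Rightarrow> complex^'n \<Rightarrow> complex^'n" where
  "poly_apply A p u = (\<Sum>k\<le>degree p. coeff p k *s (((*v) A) ^^ k) u)"

lemma poly_apply_degree_le:
  assumes "degree p \<le> m"
  shows "poly_apply A p u = (\<Sum>k\<le>m. coeff p k *s (((*v) A) ^^ k) u)"
  unfolding poly_apply_def using assms
  by (intro sum.mono_neutral_left) (auto simp: coeff_eq_0)

lemma poly_apply_add: "poly_apply A (p + q) u = poly_apply A p u + poly_apply A q u"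
proof -
  let ?m = "max (degree p) (degree q)"
  have "degree (p + q) \<le> ?m" by (rule degree_add_le) auto
  then show ?thesis
    by (simp add: poly_apply_degree_le[of _ ?m] vector_sadd_rdistrib sum.distrib)
qed

lemma poly_apply_smult: "poly_apply A (smult a p) u = a *s poly_apply A p u"
  using degree_smult_le[of a p]
  by (simp add: poly_apply_degree_le[of _ "degree p"] vec.scale_sum_right vector_smult_assoc
      poly_apply_def)

lemma poly_apply_diff: "poly_apply A (p - q) u = poly_apply A p u - poly_apply A q u"
proof -
  have "p - q = p + smult (-1) q" by simp
  then show ?thesis by (simp only: poly_apply_add poly_apply_smult) (simp add: vec.scale_minus_left)
qed

lemma poly_apply_pCons_0: "poly_apply A (pCons 0 p) u = A *v poly_apply A p u"
proof -
  have "poly_apply A (pCons 0 p) u =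
      (\<Sum>k\<le>Suc (degree p). coeff (pCons 0 p) k *s (((*v) A) ^^ k) u)"
    by (rule poly_apply_degree_le) simp
  also have "\<dots> = (\<Sum>k\<le>degree p. coeff p k *s (((*v) A) ^^ Suc k) u)"
    by (subst sum.atMost_Suc_shift) simp
  also have "\<dots> = A *v poly_apply A p u"
    by (simp add: poly_apply_def vec.sum vec.scale)
  finally show ?thesis .
qed

lemma poly_apply_linear_factor:
  "poly_apply A ([:-z, 1:] * p) u = A *v poly_apply A p u - z *s poly_apply A p u"
proof -
  have "[:-z, 1:] * p = smult (-z) p + pCons 0 p" by (simp add: mult_pCons_left)
  then show ?thesis
    by (simp only: poly_apply_add poly_apply_smult poly_apply_pCons_0) (simp add: vec.scale_minus_left)
qed

lemma poly_apply_monom: "poly_apply A (monom c k) u = c *s (((*v) A) ^^ k) u"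
proof -
  have "poly_apply A (monom c k) u = (\<Sum>j\<le>k. coeff (monom c k) j *s (((*v) A) ^^ j) u)"
    by (rule poly_apply_degree_le) (simp add: degree_monom_le)
  also have "\<dots> = (\<Sum>j\<le>k. (if j = k then c *s (((*v) A) ^^ j) u else 0))"
    by (intro sum.cong refl) (auto simp: coeff_monom)
  finally show ?thesis by simp
qed

lemma poly_apply_in_invariant_subspace:
  assumes "vec.subspace W" "\<forall>v\<in>W. A *v v \<in> W" "u \<in> W"
  shows "poly_apply A p u \<in> W"
proof -
  have "(((*v) A) ^^ k) u \<in> W" for k
    by (induction k) (use assms in auto)
  then show ?thesis unfolding poly_apply_def
    by (intro vec.subspace_sum assms(1) vec.subspace_scale) auto
qed

lemma annihilating_poly_of_dependent:
  fixes A :: "complex^'n^'n" and w :: "complex^'n"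
  defines "f \<equiv> \<lambda>k. (((*v) A) ^^ k) w"
  assumes inj: "inj_on f {..N}" and dep: "vec.dependent (f ` {..N})"
  shows "\<exists>p. p \<noteq> 0 \<and> poly_apply A p w = 0"
proof -
  obtain t u where t: "finite t" "t \<subseteq> f ` {..N}" "(\<Sum>v\<in>t. u v *s v) = 0"
    and nontrivial: "\<exists>v\<in>t. u v \<noteq> 0"
    using dep unfolding vec.dependent_explicit by blast
  define K where "K = {k \<in> {..N}. f k \<in> t}"
  define p where "p = (\<Sum>k\<in>K. monom (u (f k)) k)"
  have coeff_p: "coeff p k = (if k \<in> K then u (f k) else 0)" for k
    unfolding p_def coeff_sum by (simp add: coeff_monom K_def sum.delta' cong: if_cong)
  have "degree p \<le> N"
    by (rule degree_le) (auto simp: coeff_p K_def)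
  have inj_K: "inj_on f K" using inj by (rule inj_on_subset) (auto simp: K_def)
  have image_K: "f ` K = t" using t(2) by (auto simp: K_def)
  have "poly_apply A p w = (\<Sum>k\<le>N. coeff p k *s f k)"
    by (simp add: poly_apply_degree_le[OF \<open>degree p \<le> N\<close>] f_def)
  also have "\<dots> = (\<Sum>k\<in>K. u (f k) *s f k)"
    by (rule sum.mono_neutral_cong_right) (auto simp: coeff_p K_def)
  also have "\<dots> = 0"
    using sum.reindex[OF inj_K, of "\<lambda>v. u v *s v"] image_K t(3) by simp
  finally have "poly_apply A p w = 0" .
  moreover have "p \<noteq> 0"
    using nontrivial image_K coeff_p by (metis coeff_0 imageE)
  ultimately show ?thesis by blast
qed

text \<open>The \<open>N + 1\<close> Krylov vectors \<open>A\<^sup>k w\<close>, \<open>k \<le> N\<close>, cannot be distinct and linearly independent.\<close>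

lemma annihilating_poly_exists:
  fixes A :: "complex^'n^'n"
  shows "\<exists>p. p \<noteq> 0 \<and> poly_apply A p w = 0"
proof -
  define N where "N = CARD('n)"
  define f where "f k = (((*v) A) ^^ k) w" for k
  show ?thesis
  proof (cases "inj_on f {..N}")
    case False
    then obtain i j where ij: "i \<noteq> j" "f i = f j" by (auto simp: inj_on_def)
    let ?p = "monom (1::complex) i - monom 1 j"
    have "coeff ?p i = 1" using ij by (simp add: coeff_monom)
    then have "?p \<noteq> 0" by (metis coeff_0 one_neq_zero)
    moreover have "poly_apply A ?p w = 0"
      using ij by (simp add: poly_apply_diff poly_apply_monom f_def)
    ultimately show ?thesis by blast
  next
    case True
    have "vec.dependent (f ` {..N})"
    proof (rule ccontr)
      assume "vec.independent (f ` {..N})"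
      then have "card (f ` {..N}) \<le> vec.dim (UNIV :: (complex^'n) set)"
        using vec.independent_bound_general vec.dim_subset[of "f ` {..N}" UNIV] by fastforce
      then show False using True by (simp add: card_image N_def card_cart_basis)
    qed
    with True show ?thesis unfolding f_def by (rule annihilating_poly_of_dependent)
  qed
qed

lemma eigenvector_from_annihilating_poly:
  assumes W: "vec.subspace W" "\<forall>v\<in>W. A *v v \<in> W"
  shows "p \<noteq> 0 \<Longrightarrow> w \<in> W \<Longrightarrow> w \<noteq> 0 \<Longrightarrow> poly_apply A p w = 0 \<Longrightarrow>
     \<exists>v z. v \<in> W \<and> v \<noteq> 0 \<and> A *v v = z *s v"
proof (induction "degree p" arbitrary: p rule: less_induct)
  case less
  show ?case
  proof (cases "degree p = 0")
    case True
    then obtain a where "p = [:a:]" by (metis degree_0_id)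
    then show ?thesis using less.prems by (simp add: poly_apply_def vec.scale_eq_0_iff)
  next
    case False
    then obtain z where "poly p z = 0"
      using fundamental_theorem_of_algebra constant_degree by metis
    then obtain q where pq: "p = [:-z, 1:] * q" by (auto simp: poly_eq_0_iff_dvd dvd_def)
    with less.prems have "q \<noteq> 0" by auto
    then have "degree q < degree p" unfolding pq by (subst degree_mult_eq) auto
    show ?thesis
    proof (cases "poly_apply A q w = 0")
      case True
      show ?thesis
        by (rule less.hyps[OF \<open>degree q < degree p\<close> \<open>q \<noteq> 0\<close> less.prems(2,3) True])
    next
      case False
      have "A *v poly_apply A q w = z *s poly_apply A q w"
        using less.prems(4) unfolding pq poly_apply_linear_factor by simp
      moreover have "poly_apply A q w \<in> W"
        by (rule poly_apply_in_invariant_subspace[OF W less.prems(2)])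
      ultimately show ?thesis using False by blast
    qed
  qed
qed

lemma eigenvector_in_invariant_subspace:
  fixes A :: "complex^'n^'n"
  assumes "vec.subspace W" "\<forall>v\<in>W. A *v v \<in> W" "w \<in> W" "w \<noteq> 0"
  shows "\<exists>v z. v \<in> W \<and> v \<noteq> 0 \<and> A *v v = z *s v"
  using annihilating_poly_exists[of A w] eigenvector_from_annihilating_poly[OF assms(1,2)] assms(3,4)
  by blast

definition orthonormal_eigenset :: "complex^'n^'n \<Rightarrow> (complex^'n) set \<Rightarrow> bool" where
  "orthonormal_eigenset A S \<longleftrightarrow> finite S \<and>
     (\<forall>s\<in>S. cinner s s = 1 \<and> (\<exists>z. A *v s = z *s s)) \<and>
     (\<forall>s\<in>S. \<forall>s'\<in>S. s \<noteq> s' \<longrightarrow> cinner s s' = 0)"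

lemma orthonormal_eigenset_cinner:
  "orthonormal_eigenset A S \<Longrightarrow> s \<in> S \<Longrightarrow> s' \<in> S \<Longrightarrow> cinner s s' = (if s' = s then 1 else 0)"
  unfolding orthonormal_eigenset_def by auto

lemma orthogonal_complement_nonzero:
  fixes S :: "(complex^'n) set"
  assumes S: "orthonormal_eigenset A S" and "card S < CARD('n)"
  obtains w where "w \<noteq> 0" "\<forall>s\<in>S. cinner s w = 0"
proof -
  have fin: "finite S" using S by (simp add: orthonormal_eigenset_def)
  have "vec.span S \<noteq> UNIV"
    using vec.span_card_ge_dim[of S UNIV] fin assms(2) by (auto simp: card_cart_basis)
  then obtain x where x: "x \<notin> vec.span S" by blast
  define w where "w = x - (\<Sum>s\<in>S. cinner s x *s s)"
  have "w \<noteq> 0"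
  proof
    assume "w = 0"
    then have "x = (\<Sum>s\<in>S. cinner s x *s s)" by (simp add: w_def)
    also have "\<dots> \<in> vec.span S" by (intro vec.span_sum vec.span_scale vec.span_base)
    finally show False using x by simp
  qed
  moreover have "cinner s' w = 0" if "s' \<in> S" for s'
  proof -
    have "cinner s' w = cinner s' x - (\<Sum>s\<in>S. if s = s' then cinner s x else 0)"
      unfolding w_def cinner_diff_right cinner_sum_right cinner_scale_right
      using orthonormal_eigenset_cinner[OF S that] by (intro arg_cong2[where f=minus] sum.cong) auto
    then show ?thesis using that fin by (simp add: sum.delta)
  qed
  ultimately show ?thesis using that by blast
qed

lemma skew_orthogonal_complement_invariant:
  fixes \<Omega> :: "real^'n^'n"
  assumes skew: "transpose \<Omega> = - \<Omega>" and eig: "\<forall>s\<in>S. \<exists>z. cmat \<Omega> *v s = z *s s"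
    and v: "\<forall>s\<in>S. cinner s v = 0"
  shows "\<forall>s\<in>S. cinner s (cmat \<Omega> *v v) = 0"
proof
  fix s assume "s \<in> S"
  then obtain z where "cmat \<Omega> *v s = z *s s" using eig by blast
  then show "cinner s (cmat \<Omega> *v v) = 0"
    using v \<open>s \<in> S\<close> by (simp add: cinner_skew[OF skew] cinner_scale_left)
qed

lemma unit_eigenvector_orthogonal_to:
  fixes \<Omega> :: "real^'n^'n"
  assumes skew: "transpose \<Omega> = - \<Omega>"
    and S: "orthonormal_eigenset (cmat \<Omega>) S" and card: "card S < CARD('n)"
  obtains v z where "cinner v v = 1" "cmat \<Omega> *v v = z *s v" "\<forall>s\<in>S. cinner s v = 0"
proof -
  define W where "W = {u. \<forall>s\<in>S. cinner s u = 0}"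
  have "vec.subspace W"
    unfolding vec.subspace_def W_def by (simp add: cinner_add_right cinner_scale_right)
  moreover have "\<forall>v\<in>W. cmat \<Omega> *v v \<in> W"
  proof
    fix v assume "v \<in> W"
    then show "cmat \<Omega> *v v \<in> W"
      using skew_orthogonal_complement_invariant[OF skew, of S v] S
      by (simp add: W_def orthonormal_eigenset_def)
  qed
  moreover obtain w where "w \<noteq> 0" "w \<in> W"
    using orthogonal_complement_nonzero[OF S card] by (auto simp: W_def)
  ultimately obtain v z where v: "v \<in> W" "v \<noteq> 0" "cmat \<Omega> *v v = z *s v"
    using eigenvector_in_invariant_subspace by blast
  define r where "r = (\<Sum>i\<in>UNIV. (cmod (v$i))\<^sup>2)"
  have "r > 0" using cinner_self_pos[OF v(2)] by (simp add: r_def)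
  define v' where "v' = complex_of_real (1 / sqrt r) *s v"
  have "cinner v v = of_real r" by (simp add: r_def cinner_self)
  moreover have "(complex_of_real (sqrt r))\<^sup>2 = complex_of_real r"
    using \<open>r > 0\<close> by (simp flip: of_real_power)
  ultimately have "cinner v' v' = 1"
    unfolding v'_def cinner_scale_left cinner_scale_right using \<open>r > 0\<close>
    by (simp add: field_simps power2_eq_square[symmetric] flip: of_real_mult)
  moreover have "cmat \<Omega> *v v' = z *s v'"
    unfolding v'_def by (simp add: vec.scale v(3) vector_smult_assoc mult.commute)
  moreover have "v' \<in> W" unfolding v'_def W_def using v(1) by (simp add: W_def cinner_scale_right)
  ultimately show ?thesis using that by (auto simp: W_def)
qed

lemma orthonormal_eigenset_extend:
  fixes \<Omega> :: "real^'n^'n"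
  assumes skew: "transpose \<Omega> = - \<Omega>"
    and S: "orthonormal_eigenset (cmat \<Omega>) S" and card: "card S < CARD('n)"
  shows "\<exists>S'. orthonormal_eigenset (cmat \<Omega>) S' \<and> card S' = Suc (card S)"
proof -
  obtain v z where v: "cinner v v = 1" "cmat \<Omega> *v v = z *s v" "\<forall>s\<in>S. cinner s v = 0"
    using unit_eigenvector_orthogonal_to[OF skew S card] .
  have fin: "finite S" using S by (simp add: orthonormal_eigenset_def)
  have "v \<notin> S" using v by force
  moreover have "cinner v s = 0" if "s \<in> S" for s
    using v(3) that cinner_commute[of v s] by simp
  ultimately have "orthonormal_eigenset (cmat \<Omega>) (insert v S)"
    using S v fin unfolding orthonormal_eigenset_def by blast
  then show ?thesis using fin \<open>v \<notin> S\<close> by auto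
qed

lemma orthonormal_eigenset_exists:
  fixes \<Omega> :: "real^'n^'n"
  assumes "transpose \<Omega> = - \<Omega>"
  shows "k \<le> CARD('n) \<Longrightarrow> \<exists>S. orthonormal_eigenset (cmat \<Omega>) S \<and> card S = k"
proof (induction k)
  case 0
  have "orthonormal_eigenset (cmat \<Omega>) {}" by (simp add: orthonormal_eigenset_def)
  then show ?case by force
next
  case (Suc k)
  then obtain S where "orthonormal_eigenset (cmat \<Omega>) S" "card S = k" by auto
  with orthonormal_eigenset_extend[OF assms this(1)] Suc.prems show ?case by auto
qed

definition ctranspose :: "complex^'n^'m \<Rightarrow> complex^'m^'n" where
  "ctranspose U = (\<chi> i j. cnj (U$j$i))"

lemma orthonormal_eigenbasis:
  fixes A :: "complex^'n^'n"
  assumes S: "orthonormal_eigenset A S" "card S = CARD('n)"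
  obtains b :: "'n \<Rightarrow> complex^'n" and l where "\<And>j k. cinner (b j) (b k) = (if j = k then 1 else 0)"
    "\<And>k. A *v b k = l k *s b k"
proof -
  obtain b where b: "bij_betw b (UNIV::'n set) S"
    using S finite_same_card_bij[of "UNIV::'n set" S] by (auto simp: orthonormal_eigenset_def)
  then have bS: "b k \<in> S" for k by (auto simp: bij_betw_def)
  have "cinner (b j) (b k) = (if j = k then 1 else 0)" for j k
    using orthonormal_eigenset_cinner[OF S(1) bS bS] b by (auto simp: bij_betw_def inj_on_def)
  moreover have "\<exists>z. A *v b k = z *s b k" for k
    using S(1) bS[of k] unfolding orthonormal_eigenset_def by blast
  then have "A *v b k = (SOME z. A *v b k = z *s b k) *s b k" for k by (rule someI_ex)
  ultimately show ?thesis by (rule that[of b "\<lambda>k. SOME z. A *v b k = z *s b k"])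
qed

lemma eigenbasis_diagonalization:
  fixes A :: "complex^'n^'n" and b :: "'n \<Rightarrow> complex^'n"
  assumes orthonormal: "\<And>j k. cinner (b j) (b k) = (if j = k then 1 else 0)"
    and eigen: "\<And>k. A *v b k = l k *s b k"
  defines "U \<equiv> \<chi> i j. b j $ i"
  shows "ctranspose U ** U = mat 1" "U ** ctranspose U = mat 1" "A = U ** diag_mat l ** ctranspose U"
proof -
  have "(ctranspose U ** U) $ j $ k = cinner (b j) (b k)" for j k
    by (simp add: ctranspose_def U_def matrix_matrix_mult_def cinner_def)
  then show UU: "ctranspose U ** U = mat 1"
    by (simp add: vec_eq_iff orthonormal mat_def)
  then show UU': "U ** ctranspose U = mat 1" using matrix_left_right_inverse by blast
  have "(A ** U) $ i $ j = (U ** diag_mat l) $ i $ j" for i j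
  proof -
    have "(A ** U) $ i $ j = (A *v b j) $ i"
      by (simp add: U_def matrix_matrix_mult_def matrix_vector_mult_def)
    also have "\<dots> = (U ** diag_mat l) $ i $ j"
      by (simp add: eigen U_def diag_mat_def matrix_matrix_mult_def mult.commute if_distrib
          cong: if_cong)
    finally show ?thesis .
  qed
  then have "A ** U = U ** diag_mat l" by (simp add: vec_eq_iff)
  then have "A ** (U ** ctranspose U) = U ** diag_mat l ** ctranspose U"
    by (simp add: matrix_mul_assoc)
  then show "A = U ** diag_mat l ** ctranspose U" by (simp add: UU')
qed

theorem skew_unitary_diagonalization:
  fixes \<Omega> :: "real^'n^'n"
  assumes skew: "transpose \<Omega> = - \<Omega>"
  obtains U :: "complex^'n^'n" and l where "ctranspose U ** U = mat 1" "U ** ctranspose U = mat 1"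
    "cmat \<Omega> = U ** diag_mat l ** ctranspose U" "\<forall>k. Re (l k) = 0"
proof -
  obtain S where "orthonormal_eigenset (cmat \<Omega>) S" "card S = CARD('n)"
    using orthonormal_eigenset_exists[OF skew, of "CARD('n)"] by auto
  then obtain b :: "'n \<Rightarrow> complex^'n" and l where orthonormal: "\<And>j k. cinner (b j) (b k) = (if j = k then 1 else 0)"
    and eigen: "\<And>k. cmat \<Omega> *v b k = l k *s b k"
    by (rule orthonormal_eigenbasis) blast
  have "Re (l k) = 0" for k
  proof -
    have "l k = cinner (b k) (cmat \<Omega> *v b k)" by (simp add: eigen cinner_scale_right orthonormal)
    also have "\<dots> = - cinner (cmat \<Omega> *v b k) (b k)" by (rule cinner_skew[OF skew])
    also have "\<dots> = - cnj (l k)" by (simp add: eigen cinner_scale_left orthonormal)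
    finally have "l k = - cnj (l k)" .
    then show ?thesis by (simp add: complex_eq_iff)
  qed
  with eigenbasis_diagonalization[OF orthonormal eigen] show ?thesis by (intro that) auto
qed

section \<open>The group inverse\<close>

lemma matrix_inv_inverse:
  fixes V :: "'a::semiring_1^'n^'n"
  assumes "invertible V"
  shows "V ** matrix_inv V = mat 1 \<and> matrix_inv V ** V = mat 1"
  using assms unfolding invertible_def matrix_inv_def by (rule someI_ex)

lemma matrix_inv_eq:
  fixes V :: "'a::semiring_1^'n^'n"
  assumes "V ** U = mat 1" "U ** V = mat 1"
  shows "matrix_inv V = U"
proof -
  have "invertible V" using assms unfolding invertible_def by blast
  have "matrix_inv V = matrix_inv V ** (V ** U)" by (simp add: assms)
  also have "\<dots> = U" using matrix_inv_inverse[OF \<open>invertible V\<close>] by (simp add: matrix_mul_assoc)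
  finally show ?thesis .
qed

lemma diag_mat_mult: "diag_mat a ** diag_mat b = diag_mat (\<lambda>k. a k * b k)"
proof -
  have "(if i = k then a i else 0) * (if k = j then b k else 0) =
      (if k = i then (if i = j then a i * b i else 0) else 0)" for i j k :: 'a
    by auto
  then show ?thesis by (simp add: vec_eq_iff diag_mat_def matrix_matrix_mult_def sum.delta')
qed

lemma diag_mat_one: "diag_mat (\<lambda>_. 1) = mat 1"
  by (simp add: vec_eq_iff diag_mat_def mat_def)

lemma conjugated_mult:
  assumes "V ** W = mat 1"
  shows "(W ** D1 ** V) ** (W ** D2 ** V) = W ** (D1 ** D2) ** V"
proof -
  have "(W ** D1 ** V) ** (W ** D2 ** V) = W ** D1 ** (V ** W) ** D2 ** V"
    by (simp add: matrix_mul_assoc)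
  then show ?thesis by (simp add: assms matrix_mul_assoc)
qed

definition group_inverse :: "'a::semiring_1^'n^'n \<Rightarrow> 'a^'n^'n \<Rightarrow> bool" where
  "group_inverse A X \<longleftrightarrow> A ** X = X ** A \<and> X ** A ** X = X \<and> A ** X ** A = A"

lemma group_inverse_unique:
  assumes X: "group_inverse A X" and Y: "group_inverse A Y"
  shows "X = Y"
proof -
  have X': "A ** X = X ** A" "X ** A ** X = X" "A ** X ** A = A"
    and Y': "A ** Y = Y ** A" "Y ** A ** Y = Y" "A ** Y ** A = A"
    using X Y unfolding group_inverse_def by blast+
  have XA_YA: "X ** A = (X ** A) ** (Y ** A)"
    using arg_cong[OF Y'(3), of "\<lambda>M. X ** M"] by (simp add: matrix_mul_assoc)
  have "Y ** A = (A ** X ** A) ** Y" using X'(3) Y'(1) by simp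
  also have "\<dots> = (A ** X) ** (A ** Y)" by (simp add: matrix_mul_assoc)
  finally have YA_XA: "Y ** A = (X ** A) ** (Y ** A)" using X'(1) Y'(1) by simp
  have "X ** A = Y ** A" using XA_YA YA_XA by (rule trans[OF _ sym])
  have "X = (X ** A) ** X" using X'(2) by (simp add: matrix_mul_assoc)
  also have "\<dots> = (Y ** A) ** X" using \<open>X ** A = Y ** A\<close> by simp
  also have "\<dots> = Y ** (X ** A)" by (metis X'(1) matrix_mul_assoc)
  also have "\<dots> = Y ** (Y ** A)" using \<open>X ** A = Y ** A\<close> by simp
  also have "\<dots> = Y" by (metis Y'(1,2) matrix_mul_assoc)
  finally show ?thesis .
qed

text \<open>The eigenvalues \<open>\<mu>\<^sub>i\<close> of \<open>omega_hat_inv\<close>, in terms of those of \<open>\<Omega>\<close>.\<close>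

definition pinv :: "('n \<Rightarrow> complex) \<Rightarrow> 'n \<Rightarrow> complex" where
  "pinv l i = (if l i = 0 then 0 else inverse (l i))"

lemma group_inverse_diagonalization:
  assumes "A = W ** diag_mat l ** V" "V ** W = mat 1"
  shows "group_inverse A (W ** diag_mat (pinv l) ** V)"
proof -
  have "(\<lambda>k. l k * pinv l k) = (\<lambda>k. pinv l k * l k)"
    "(\<lambda>k. pinv l k * l k * pinv l k) = pinv l"
    "(\<lambda>k. l k * pinv l k * l k) = l"
    "(\<lambda>k. pinv l k * l k * l k) = l"
    by (auto simp: pinv_def)
  then show ?thesis unfolding group_inverse_def assms
    by (simp only: conjugated_mult[OF assms(2)] diag_mat_mult)
qed

lemma cmat_mult: "cmat (A ** B) = cmat A ** cmat B"
  by (simp add: vec_eq_iff matrix_matrix_mult_def)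

lemma cmat_inj: "cmat A = cmat B \<Longrightarrow> A = B"
  by (simp add: vec_eq_iff)

lemma cmat_one: "cmat (mat 1) = mat 1"
  by (simp add: vec_eq_iff mat_def)

lemma group_inverse_cmat: "group_inverse (cmat A) (cmat X) \<Longrightarrow> group_inverse A X"
  unfolding group_inverse_def by (simp flip: cmat_mult) (auto dest: cmat_inj)

text \<open>The diagonalization in \<open>omega_hat_inv\<close> is chosen by Hilbert choice, but every admissible
  choice yields the group inverse of \<open>\<Omega>\<close>. A real admissible matrix exists because the group
  inverse is unique and hence invariant under complex conjugation.\<close>

theorem group_inverse_omega_hat_inv:
  fixes \<Omega> :: "real^'n^'n"
  assumes skew: "transpose \<Omega> = - \<Omega>"
  shows "group_inverse \<Omega> (omega_hat_inv \<Omega>)"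
proof -
  define P where "P M \<longleftrightarrow> (\<exists>(V::complex^'n^'n) l. invertible V \<and>
      cmat \<Omega> = matrix_inv V ** diag_mat l ** V \<and>
      cmat M = matrix_inv V ** diag_mat (pinv l) ** V)" for M
  have P_group_inverse: "group_inverse (cmat \<Omega>) (cmat M)" if "P M" for M
  proof -
    obtain V :: "complex^'n^'n" and l where V: "invertible V" "cmat \<Omega> = matrix_inv V ** diag_mat l ** V"
      "cmat M = matrix_inv V ** diag_mat (pinv l) ** V"
      using \<open>P M\<close> unfolding P_def by blast
    have "V ** matrix_inv V = mat 1" using matrix_inv_inverse[OF V(1)] by blast
    then show ?thesis unfolding V(3) by (rule group_inverse_diagonalization[OF V(2)])
  qed
  obtain U :: "complex^'n^'n" and l where U: "ctranspose U ** U = mat 1" "U ** ctranspose U = mat 1"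
    "cmat \<Omega> = U ** diag_mat l ** ctranspose U"
    using skew_unitary_diagonalization[OF skew] by blast
  define N where "N = U ** diag_mat (pinv l) ** ctranspose U"
  have N: "group_inverse (cmat \<Omega>) N"
    unfolding N_def using U(3,1) by (rule group_inverse_diagonalization)
  have cnj_mult: "map_matrix cnj (A ** B) = map_matrix cnj A ** map_matrix cnj B"
    for A B :: "complex^'n^'n"
    by (simp add: vec_eq_iff matrix_matrix_mult_def cnj_sum)
  have cnj_\<Omega>: "map_matrix cnj (cmat \<Omega>) = cmat \<Omega>" by (simp add: vec_eq_iff)
  have "group_inverse (cmat \<Omega>) (map_matrix cnj N)"
    using N unfolding group_inverse_def by (metis cnj_\<Omega> cnj_mult)
  then have N_real: "map_matrix cnj N = N" using N by (rule group_inverse_unique)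
  have "Im (N$i$j) = 0" for i j
  proof -
    have "cnj (N$i$j) = N$i$j" using arg_cong[OF N_real, of "\<lambda>X. X$i$j"] by simp
    then show ?thesis by (metis Reals_cnj_iff complex_is_Real_iff)
  qed
  then have real_N: "cmat (map_matrix Re N) = N" by (simp add: vec_eq_iff complex_eq_iff)
  have "invertible (ctranspose U)" using U unfolding invertible_def by blast
  moreover have "matrix_inv (ctranspose U) = U" using U by (intro matrix_inv_eq)
  ultimately have "P (map_matrix Re N)"
    unfolding P_def using U(3) by (intro exI[of _ "ctranspose U"] exI[of _ l]) (simp add: real_N, simp add: N_def)
  then have "P (omega_hat_inv \<Omega>)" unfolding omega_hat_inv_def P_def pinv_def by (rule someI)
  then show ?thesis by (intro group_inverse_cmat P_group_inverse)
qed

corollary skew_mult_omega_hat_inv: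
  "transpose \<Omega> = - \<Omega> \<Longrightarrow> \<Omega> ** \<Omega> ** omega_hat_inv \<Omega> = \<Omega>"
  using group_inverse_omega_hat_inv[of \<Omega>] unfolding group_inverse_def
  by (metis matrix_mul_assoc)

section \<open>The matrix exponential of a skew-symmetric matrix\<close>

lemma mpow_0 [simp]: "mpow A 0 = mat 1"
  by (simp add: mpow_def)

lemma mpow_Suc: "mpow A (Suc k) = mpow A k ** A"
  by (simp add: mpow_def)

lemma diag_mat_sums:
  assumes "\<And>j. (\<lambda>k. g k j) sums s j"
  shows "(\<lambda>k. diag_mat (g k)) sums diag_mat s"
proof -
  have "(\<Sum>k<n. diag_mat (g k)) = diag_mat (\<lambda>j. \<Sum>k<n. g k j)" for n
    by (induction n) (auto simp: vec_eq_iff diag_mat_def)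
  then show ?thesis
    using assms unfolding sums_def diag_mat_def by (auto intro!: tendsto_vec_lambda)
qed

lemma bounded_linear_map_Re: "bounded_linear (map_matrix Re :: complex^'n^'m \<Rightarrow> real^'n^'m)"
  by (intro linear_conv_bounded_linear[THEN iffD1] linearI) (auto simp: vec_eq_iff)

lemma map_matrix_Re_cmat: "map_matrix Re (cmat X) = X"
  by (simp add: vec_eq_iff)

lemma bounded_linear_cmat: "bounded_linear (cmat :: real^'n^'m \<Rightarrow> complex^'n^'m)"
proof -
  have "complex_of_real (r * x) = r *\<^sub>R complex_of_real x" for r x
    by (simp add: scaleR_conv_of_real)
  then show ?thesis
    by (intro linear_conv_bounded_linear[THEN iffD1] linearI)
      (simp_all add: vec_eq_iff del: of_real_mult)
qed

lemma matrix_mult_scaleR_right: "(A::'a::real_algebra_1^'n^'m) ** (c *\<^sub>R B) = c *\<^sub>R (A ** B)"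
  by (simp add: vec_eq_iff matrix_matrix_mult_def scaleR_sum_right)

lemma matrix_mult_scaleR_left: "(c *\<^sub>R A::'a::real_algebra_1^'n^'m) ** B = c *\<^sub>R (A ** B)"
  by (simp add: vec_eq_iff matrix_matrix_mult_def scaleR_sum_right)

lemma bounded_linear_conjugate:
  fixes U V :: "complex^'n^'n"
  shows "bounded_linear (\<lambda>X. U ** X ** V)"
proof -
  have add_rdistrib: "(B + C) ** A = B ** A + C ** A" for A B C :: "complex^'n^'n"
    by (vector matrix_matrix_mult_def sum.distrib[symmetric] field_simps)
  show ?thesis
    by (intro linear_conv_bounded_linear[THEN iffD1] linearI)
      (simp_all add: matrix_add_ldistrib add_rdistrib matrix_mult_scaleR_right matrix_mult_scaleR_left)
qed

lemma ctranspose_mult: "ctranspose (A ** B) = ctranspose B ** ctranspose A"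
  by (simp add: vec_eq_iff ctranspose_def matrix_matrix_mult_def cnj_sum mult.commute)

lemma ctranspose_ctranspose [simp]: "ctranspose (ctranspose A) = A"
  by (simp add: vec_eq_iff ctranspose_def)

lemma ctranspose_diag_mat: "ctranspose (diag_mat d) = diag_mat (\<lambda>k. cnj (d k))"
  by (simp add: vec_eq_iff ctranspose_def diag_mat_def)

lemma conjugate_diag_mat_entry:
  "(U ** diag_mat g ** W) $ i $ j = (\<Sum>k\<in>UNIV. U$i$k * g k * W$k$j)"
proof -
  have "(\<Sum>n\<in>UNIV. U$i$n * (if n = k then g n else 0) * W$k$j) = U$i$k * g k * W$k$j" for k
    by (simp add: if_distrib[of "\<lambda>x. U$i$_ * x * _"] sum.delta' cong: if_cong)
  then show ?thesis by (simp add: matrix_matrix_mult_def diag_mat_def sum_distrib_right)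
qed

lemma vec_lambda_has_vector_derivative:
  fixes g :: "'n::finite \<Rightarrow> real \<Rightarrow> real"
  assumes "\<And>i. (g i has_real_derivative g' i) (at t)"
  shows "((\<lambda>s. \<chi> i. g i s) has_vector_derivative (\<chi> i. g' i)) (at t)"
proof -
  have expand: "(\<chi> i. f i) = (\<Sum>i\<in>UNIV. f i *\<^sub>R axis i (1::real))" for f :: "'n \<Rightarrow> real"
    using basis_expansion[of "\<chi> i. f i"] by (simp add: scalar_mult_eq_scaleR)
  have "((\<lambda>s. \<Sum>i\<in>UNIV. g i s *\<^sub>R axis i (1::real)) has_vector_derivative
      (\<Sum>i\<in>UNIV. g' i *\<^sub>R axis i 1)) (at t)"
    by (intro has_vector_derivative_sum) (auto intro!: derivative_eq_intros assms)
  then show ?thesis by (simp only: expand)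
qed

context
  fixes \<Omega> :: "real^'n^'n" and U :: "complex^'n^'n" and l :: "'n \<Rightarrow> complex"
  assumes unitary: "ctranspose U ** U = mat 1" "U ** ctranspose U = mat 1"
    and diagonal: "cmat \<Omega> = U ** diag_mat l ** ctranspose U"
    and imaginary: "\<forall>k. Re (l k) = 0"
begin

definition mexp_diag :: "real \<Rightarrow> complex^'n^'n" where
  "mexp_diag t = U ** diag_mat (\<lambda>k. exp (t *\<^sub>R l k)) ** ctranspose U"

lemma cmat_mpow: "cmat (mpow \<Omega> k) = U ** diag_mat (\<lambda>j. l j ^ k) ** ctranspose U"
proof (induction k)
  case 0
  show ?case by (simp add: cmat_one diag_mat_one unitary)
next
  case (Suc k)
  have "cmat (mpow \<Omega> (Suc k)) = U ** (diag_mat (\<lambda>j. l j ^ k) ** diag_mat l) ** ctranspose U"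
    by (simp only: mpow_Suc cmat_mult Suc diagonal conjugated_mult[OF unitary(1)])
  then show ?case by (simp add: diag_mat_mult mult.commute)
qed

lemma cmat_mexp: "cmat (mexp \<Omega> t) = mexp_diag t"
proof -
  define c where "c k = t ^ k / fact k" for k
  have summand: "cmat (c k *\<^sub>R mpow \<Omega> k) =
      U ** diag_mat (\<lambda>j. (t *\<^sub>R l j) ^ k /\<^sub>R fact k) ** ctranspose U" for k
  proof -
    have "cmat (c k *\<^sub>R mpow \<Omega> k) = c k *\<^sub>R cmat (mpow \<Omega> k)"
      by (rule linear_scale[OF bounded_linear.linear[OF bounded_linear_cmat]])
    also have "\<dots> = U ** (c k *\<^sub>R diag_mat (\<lambda>j. l j ^ k)) ** ctranspose U"
      by (simp add: cmat_mpow matrix_mult_scaleR_right matrix_mult_scaleR_left)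
    also have "c k *\<^sub>R diag_mat (\<lambda>j. l j ^ k) = diag_mat (\<lambda>j. c k *\<^sub>R l j ^ k)"
      by (simp add: vec_eq_iff diag_mat_def)
    also have "(\<lambda>j. c k *\<^sub>R l j ^ k) = (\<lambda>j. (t *\<^sub>R l j) ^ k /\<^sub>R fact k)"
      by (simp add: fun_eq_iff c_def scaleR_conv_of_real power_mult_distrib field_simps)
    finally show ?thesis .
  qed
  have complex_sums: "(\<lambda>k. cmat (c k *\<^sub>R mpow \<Omega> k)) sums mexp_diag t"
    unfolding summand mexp_diag_def
    by (intro bounded_linear.sums[OF bounded_linear_conjugate] diag_mat_sums exp_converges)
  have "(\<lambda>k. c k *\<^sub>R mpow \<Omega> k) sums map_matrix Re (mexp_diag t)"
    using bounded_linear.sums[OF bounded_linear_map_Re complex_sums] by (simp only: map_matrix_Re_cmat)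
  then have "mexp \<Omega> t = map_matrix Re (mexp_diag t)"
    unfolding mexp_def c_def by (simp add: sums_iff)
  then have "(\<lambda>k. cmat (c k *\<^sub>R mpow \<Omega> k)) sums cmat (mexp \<Omega> t)"
    using bounded_linear.sums[OF bounded_linear_cmat \<open>(\<lambda>k. c k *\<^sub>R mpow \<Omega> k) sums _\<close>] by simp
  with complex_sums show ?thesis using sums_unique2 by blast
qed

lemma mexp_add_diag: "mexp \<Omega> (s + t) = mexp \<Omega> s ** mexp \<Omega> t"
  by (rule cmat_inj)
    (simp add: cmat_mult cmat_mexp mexp_diag_def conjugated_mult[OF unitary(1)] diag_mat_mult
      scaleR_add_left exp_add)

lemma mexp_zero_diag: "mexp \<Omega> 0 = mat 1"
  by (rule cmat_inj) (simp add: cmat_mexp mexp_diag_def diag_mat_one unitary cmat_one)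

lemma orthogonal_matrix_mexp_diag: "orthogonal_matrix (mexp \<Omega> t)"
proof -
  have unimodular: "cnj (exp (t *\<^sub>R l k)) * exp (t *\<^sub>R l k) = 1" for k
  proof -
    have "cnj (t *\<^sub>R l k) = - (t *\<^sub>R l k)" using imaginary by (simp add: complex_eq_iff)
    then show ?thesis by (simp add: exp_cnj exp_minus_inverse mult.commute)
  qed
  have transpose: "cmat (transpose (mexp \<Omega> t)) = ctranspose (mexp_diag t)"
    unfolding cmat_mexp[symmetric] by (simp add: vec_eq_iff ctranspose_def transpose_def)
  have "ctranspose (mexp_diag t) = U ** diag_mat (\<lambda>k. cnj (exp (t *\<^sub>R l k))) ** ctranspose U"
    by (simp add: mexp_diag_def ctranspose_mult ctranspose_ctranspose ctranspose_diag_mat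
        matrix_mul_assoc)
  then have "ctranspose (mexp_diag t) ** mexp_diag t = mat 1"
    by (simp add: mexp_diag_def conjugated_mult[OF unitary(1)] diag_mat_mult unimodular
        diag_mat_one unitary)
  then have "cmat (transpose (mexp \<Omega> t) ** mexp \<Omega> t) = cmat (mat 1)"
    by (simp add: cmat_mult transpose cmat_mexp cmat_one)
  then show ?thesis unfolding orthogonal_matrix by (rule cmat_inj)
qed

lemma mexp_entry:
  "mexp \<Omega> t $ i $ j = Re (\<Sum>k\<in>UNIV. U$i$k * exp (t *\<^sub>R l k) * cnj (U$j$k))"
proof -
  have "complex_of_real (mexp \<Omega> t $ i $ j) = mexp_diag t $ i $ j"
    using arg_cong[OF cmat_mexp[of t], of "\<lambda>X. X$i$j"] by simp
  also have "\<dots> = (\<Sum>k\<in>UNIV. U$i$k * exp (t *\<^sub>R l k) * cnj (U$j$k))"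
    by (simp add: mexp_diag_def conjugate_diag_mat_entry ctranspose_def)
  finally show ?thesis by (metis Re_complex_of_real)
qed

lemma continuous_on_mexp_diag: "continuous_on UNIV (mexp \<Omega>)"
proof -
  have "mexp \<Omega> = (\<lambda>t. \<chi> i j. Re (\<Sum>k\<in>UNIV. U$i$k * exp (t *\<^sub>R l k) * cnj (U$j$k)))"
    by (rule ext) (simp only: vec_eq_iff vec_lambda_beta mexp_entry simp_thms)
  then show ?thesis
    by (simp only:) (intro continuous_on_vec_lambda continuous_on_Re continuous_on_sum
        continuous_on_mult continuous_intros)
qed

lemma mexp_mult_entry:
  "(mexp \<Omega> t ** \<Omega>) $ i $ j = Re (\<Sum>k\<in>UNIV. U$i$k * (exp (t *\<^sub>R l k) * l k) * cnj (U$j$k))"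
proof -
  have "cmat (mexp \<Omega> t ** \<Omega>) = U ** diag_mat (\<lambda>k. exp (t *\<^sub>R l k) * l k) ** ctranspose U"
    by (simp add: cmat_mult cmat_mexp diagonal mexp_diag_def conjugated_mult[OF unitary(1)]
        diag_mat_mult)
  from arg_cong[OF this, of "\<lambda>X. X$i$j"]
  have "complex_of_real ((mexp \<Omega> t ** \<Omega>) $ i $ j) =
      (\<Sum>k\<in>UNIV. U$i$k * (exp (t *\<^sub>R l k) * l k) * cnj (U$j$k))"
    by (simp add: conjugate_diag_mat_entry ctranspose_def)
  then show ?thesis by (metis Re_complex_of_real)
qed

lemma has_vector_derivative_mexp_uminus_diag:
  "((\<lambda>s. mexp \<Omega> (-s) *v w) has_vector_derivative - (mexp \<Omega> (-t) *v (\<Omega> *v w))) (at t)"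
proof -
  define g where
    "g i s = (\<Sum>j\<in>UNIV. Re (\<Sum>k\<in>UNIV. U$i$k * exp (s *\<^sub>R (- l k)) * cnj (U$j$k)) * w$j)" for i s
  define g' where
    "g' i = (\<Sum>j\<in>UNIV. Re (\<Sum>k\<in>UNIV. U$i$k * (exp (t *\<^sub>R (- l k)) * (- l k)) * cnj (U$j$k)) * w$j)"
    for i
  have "(g i has_real_derivative g' i) (at t)" for i
    unfolding g_def g'_def has_real_derivative_iff_has_vector_derivative
    by (intro has_vector_derivative_sum has_vector_derivative_mult_left
        bounded_linear.has_vector_derivative[OF bounded_linear_Re]
        has_vector_derivative_mult_right exp_scaleR_has_vector_derivative_right)
  moreover have "(\<lambda>s. mexp \<Omega> (-s) *v w) = (\<lambda>s. \<chi> i. g i s)"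
    by (simp add: vec_eq_iff g_def matrix_vector_mult_def mexp_entry)
  moreover have "g' i = - (mexp \<Omega> (-t) *v (\<Omega> *v w)) $ i" for i
  proof -
    have "(mexp \<Omega> (-t) *v (\<Omega> *v w)) $ i = ((mexp \<Omega> (-t) ** \<Omega>) *v w) $ i"
      by (simp add: matrix_vector_mul_assoc)
    also have "\<dots> = (\<Sum>j\<in>UNIV. Re (\<Sum>k\<in>UNIV. U$i$k * (exp ((-t) *\<^sub>R l k) * l k) * cnj (U$j$k)) * w$j)"
      by (simp add: matrix_vector_mult_def mexp_mult_entry)
    finally have rhs: "(mexp \<Omega> (-t) *v (\<Omega> *v w)) $ i =
        (\<Sum>j\<in>UNIV. Re (\<Sum>k\<in>UNIV. U$i$k * (exp ((-t) *\<^sub>R l k) * l k) * cnj (U$j$k)) * w$j)" .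
    have "U$i$k * (exp (t *\<^sub>R (- l k)) * (- l k)) * cnj (U$j$k) =
        - (U$i$k * (exp ((-t) *\<^sub>R l k) * l k) * cnj (U$j$k))" for j k
      by simp
    then show ?thesis
      unfolding rhs by (simp only: g'_def sum_negf uminus_complex.sel mult_minus_left)
  qed
  then have "(\<chi> i. g' i) = - (mexp \<Omega> (-t) *v (\<Omega> *v w))" by (simp add: vec_eq_iff)
  ultimately show ?thesis using vec_lambda_has_vector_derivative[of g g' t] by simp
qed

end

lemma mexp_add:
  assumes "transpose \<Omega> = - \<Omega>"
  shows "mexp \<Omega> (s + t) = mexp \<Omega> s ** mexp \<Omega> t"
  using assms by (rule skew_unitary_diagonalization) (rule mexp_add_diag)

lemma mexp_zero:
  assumes "transpose \<Omega> = - \<Omega>"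
  shows "mexp \<Omega> 0 = mat 1"
  using assms by (rule skew_unitary_diagonalization) (rule mexp_zero_diag)

lemma orthogonal_matrix_mexp:
  assumes "transpose \<Omega> = - \<Omega>"
  shows "orthogonal_matrix (mexp \<Omega> t)"
  using assms by (rule skew_unitary_diagonalization) (rule orthogonal_matrix_mexp_diag)

lemma continuous_on_mexp:
  assumes "transpose \<Omega> = - \<Omega>"
  shows "continuous_on UNIV (mexp \<Omega>)"
  using assms by (rule skew_unitary_diagonalization) (rule continuous_on_mexp_diag)

lemma has_vector_derivative_mexp_uminus:
  assumes "transpose \<Omega> = - \<Omega>"
  shows "((\<lambda>s. mexp \<Omega> (-s) *v w) has_vector_derivative - (mexp \<Omega> (-t) *v (\<Omega> *v w))) (at t)"
  using assms by (rule skew_unitary_diagonalization) (rule has_vector_derivative_mexp_uminus_diag)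

section \<open>Means of almost periodic functions\<close>

definition has_tavg :: "(real \<Rightarrow> 'a::euclidean_space) \<Rightarrow> 'a \<Rightarrow> bool" where
  "has_tavg g c \<longleftrightarrow> ((\<lambda>T. (1 / T) *\<^sub>R integral {0..T} g) \<longlongrightarrow> c) at_top"

lemma tavg_eqI: "has_tavg g c \<Longrightarrow> tavg g = c"
  unfolding has_tavg_def tavg_def by (rule tendsto_Lim) simp

lemma integrable_on_continuous_UNIV:
  fixes g :: "real \<Rightarrow> 'a::euclidean_space"
  shows "continuous_on UNIV g \<Longrightarrow> g integrable_on {a..b}"
  by (rule integrable_continuous_interval) (rule continuous_on_subset, auto)

lemma has_tavg_add:
  assumes "continuous_on UNIV g" "continuous_on UNIV h" "has_tavg g a" "has_tavg h b"
  shows "has_tavg (\<lambda>t. g t + h t) (a + b)"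
proof -
  have "(1 / T) *\<^sub>R integral {0..T} (\<lambda>t. g t + h t) =
      (1 / T) *\<^sub>R integral {0..T} g + (1 / T) *\<^sub>R integral {0..T} h" for T
    using assms(1,2) by (simp add: integrable_on_continuous_UNIV integral_add scaleR_add_right)
  then show ?thesis using assms(3,4) unfolding has_tavg_def by (simp add: tendsto_add)
qed

lemma has_tavg_diff:
  assumes "continuous_on UNIV g" "continuous_on UNIV h" "has_tavg g a" "has_tavg h b"
  shows "has_tavg (\<lambda>t. g t - h t) (a - b)"
proof -
  have "(1 / T) *\<^sub>R integral {0..T} (\<lambda>t. g t - h t) =
      (1 / T) *\<^sub>R integral {0..T} g - (1 / T) *\<^sub>R integral {0..T} h" for T
    using assms(1,2) by (simp add: integrable_on_continuous_UNIV integral_diff scaleR_diff_right)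
  then show ?thesis using assms(3,4) unfolding has_tavg_def by (simp add: tendsto_diff)
qed

lemma has_tavg_const: "has_tavg (\<lambda>t. c) c"
  unfolding has_tavg_def
  by (rule tendsto_eventually) (auto simp: eventually_at_top_linorder intro: exI[of _ 1])

lemma has_tavg_bounded_linear:
  assumes "bounded_linear L" "continuous_on UNIV g" "has_tavg g a"
  shows "has_tavg (\<lambda>t. L (g t)) (L a)"
proof -
  have "(1 / T) *\<^sub>R integral {0..T} (\<lambda>t. L (g t)) = L ((1 / T) *\<^sub>R integral {0..T} g)" for T
    using integral_linear[OF integrable_on_continuous_UNIV[OF assms(2)] assms(1), of 0 T]
      linear_scale[OF bounded_linear.linear[OF assms(1)]]
    by (simp add: o_def)
  then show ?thesis
    using assms(3) bounded_linear.tendsto[OF assms(1)] unfolding has_tavg_def by simp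
qed

lemma has_tavg_nonneg:
  fixes g :: "real \<Rightarrow> real"
  assumes "continuous_on UNIV g" "\<And>t. g t \<ge> 0" "has_tavg g a"
  shows "a \<ge> 0"
proof (rule tendsto_le[OF _ assms(3)[unfolded has_tavg_def] tendsto_const])
  show "\<forall>\<^sub>F T in at_top. 0 \<le> (1 / T) *\<^sub>R integral {0..T} g"
    unfolding eventually_at_top_linorder
    by (rule exI[of _ 1]) (auto intro!: divide_nonneg_nonneg integral_nonneg integrable_on_continuous_UNIV assms)
qed simp

lemma has_tavg_zero_if_bounded_integral:
  assumes "\<And>T. T \<ge> 0 \<Longrightarrow> norm (integral {0..T} g) \<le> K"
  shows "has_tavg g 0"
  unfolding has_tavg_def
proof (rule Lim_null_comparison)
  show "\<forall>\<^sub>F T in at_top. norm ((1 / T) *\<^sub>R integral {0..T} g) \<le> K / T"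
    unfolding eventually_at_top_linorder
    using assms by (intro exI[of _ 1] allI impI) (simp add: divide_right_mono)
  show "((\<lambda>T. K / T) \<longlongrightarrow> 0) at_top"
    by (rule tendsto_divide_0[OF tendsto_const filterlim_at_top_imp_at_infinity[OF filterlim_ident]])
qed

definition almost_periodic :: "(real \<Rightarrow> 'a::metric_space) \<Rightarrow> bool" where
  "almost_periodic g \<longleftrightarrow>
    (\<forall>\<epsilon>>0. \<exists>L. \<forall>a. \<exists>\<tau>. a \<le> \<tau> \<and> \<tau> \<le> a + L \<and> (\<forall>t. dist (g (t + \<tau>)) (g t) \<le> \<epsilon>))"

lemma almost_periodic_compose:
  assumes g: "almost_periodic g" and \<phi>: "uniformly_continuous_on S \<phi>" and "range g \<subseteq> S"
  shows "almost_periodic (\<lambda>t. \<phi> (g t))"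
  unfolding almost_periodic_def
proof (intro allI impI)
  fix \<epsilon> :: real assume "\<epsilon> > 0"
  then obtain \<delta> where "\<delta> > 0" and \<delta>: "\<And>x y. x \<in> S \<Longrightarrow> y \<in> S \<Longrightarrow> dist y x < \<delta> \<Longrightarrow> dist (\<phi> y) (\<phi> x) < \<epsilon>"
    using \<phi> unfolding uniformly_continuous_on_def by metis
  then obtain L where L: "\<forall>a. \<exists>\<tau>. a \<le> \<tau> \<and> \<tau> \<le> a + L \<and> (\<forall>t. dist (g (t + \<tau>)) (g t) \<le> \<delta> / 2)"
    using g half_gt_zero unfolding almost_periodic_def by blast
  have "dist (\<phi> (g (t + \<tau>))) (\<phi> (g t)) \<le> \<epsilon>" if "dist (g (t + \<tau>)) (g t) \<le> \<delta> / 2" for t \<tau>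
    using \<delta>[of "g t" "g (t + \<tau>)"] that \<open>\<delta> > 0\<close> \<open>range g \<subseteq> S\<close> by force
  then show "\<exists>L. \<forall>a. \<exists>\<tau>. a \<le> \<tau> \<and> \<tau> \<le> a + L \<and> (\<forall>t. dist (\<phi> (g (t + \<tau>))) (\<phi> (g t)) \<le> \<epsilon>)"
    using L by meson
qed

context
  fixes g :: "real \<Rightarrow> 'a::euclidean_space" and B :: real
  assumes cont: "continuous_on UNIV g" and bnd: "\<And>t. norm (g t) \<le> B"
begin

lemma bound_nonneg: "B \<ge> 0"
  using bnd[of 0] norm_ge_zero[of "g 0"] by linarith

abbreviation J :: "real \<Rightarrow> real \<Rightarrow> 'a" where
  "J a b \<equiv> integral {a..b} g"

lemma J_split: "a \<le> b \<Longrightarrow> b \<le> c \<Longrightarrow> J a b + J b c = J a c"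
  using Henstock_Kurzweil_Integration.integral_combine[where a=a and c=b and b=c and f=g] by (auto intro: integrable_continuous_interval continuous_on_subset[OF cont])

lemma norm_J_le: "a \<le> b \<Longrightarrow> norm (J a b) \<le> B * (b - a)"
  by (rule integral_bound) (auto intro: continuous_on_subset[OF cont] bnd)

text \<open>Cut \<open>[0, N]\<close> into windows of length \<open>K \<ge> L\<close>: every window contains an \<open>\<epsilon>\<close>-almost period
  within \<open>L\<close> of its left end, so its integral is within \<open>\<epsilon>K + 2BL\<close> of \<open>\<integral>\<^sub>0\<^sup>K g\<close>. Hence the
  averages over \<open>[0, N]\<close> form a Cauchy sequence.\<close>

lemma J_window_close:
  assumes T: "T \<ge> L" and tau: "a \<le> \<tau>" "\<tau> \<le> a + L" and ap: "\<And>t. norm (g (t + \<tau>) - g t) \<le> \<epsilon>"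
  shows "norm (J a (a + T) - J 0 T) \<le> \<epsilon> * T + 2 * B * L"
proof -
  have L0: "L \<ge> 0" using tau by simp
  have T0: "T \<ge> 0" using T L0 by simp
  have sh: "integral {\<tau>..\<tau> + T} g = integral {0..T} (\<lambda>t. g (t + \<tau>))"
    using integral_shift_real_ivl[where a="\<tau>" and b="\<tau> + T" and c="\<tau>" and f=g] by simp
  have "norm (J \<tau> (\<tau> + T) - J 0 T) = norm (integral {0..T} (\<lambda>t. g (t + \<tau>) - g t))"
    unfolding sh
    by (subst integral_diff) (auto intro!: integrable_continuous_interval continuous_intros
        continuous_on_compose2[OF cont] continuous_on_subset[OF cont])
  also have "\<dots> \<le> \<epsilon> * (T - 0)"
    by (rule integral_bound) (auto intro!: continuous_intros continuous_on_compose2[OF cont] ap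
        continuous_on_subset[OF cont] T0)
  finally have e1: "norm (J \<tau> (\<tau> + T) - J 0 T) \<le> \<epsilon> * T" by simp
  have c1: "J a (a + T) = J a \<tau> + J \<tau> (a + T)" using tau T by (simp add: J_split)
  have c2: "J \<tau> (\<tau> + T) = J \<tau> (a + T) + J (a + T) (\<tau> + T)" using tau T by (simp add: J_split)
  have "norm (J a (a + T) - J \<tau> (\<tau> + T)) = norm (J a \<tau> - J (a + T) (\<tau> + T))"
    unfolding c1 c2 by (simp add: algebra_simps)
  also have "\<dots> \<le> norm (J a \<tau>) + norm (J (a + T) (\<tau> + T))" by (rule norm_triangle_ineq4)
  also have "\<dots> \<le> B * (\<tau> - a) + B * ((\<tau> + T) - (a + T))"
    using tau by (intro add_mono norm_J_le) auto
  also have "\<dots> \<le> 2 * B * L"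
  proof -
    have "B * (\<tau> - a) \<le> B * L" using tau bound_nonneg by (intro mult_left_mono) auto
    then show ?thesis by simp
  qed
  finally have e2: "norm (J a (a + T) - J \<tau> (\<tau> + T)) \<le> 2 * B * L" .
  have "norm (J a (a + T) - J 0 T) \<le> norm (J a (a + T) - J \<tau> (\<tau> + T)) + norm (J \<tau> (\<tau> + T) - J 0 T)"
    using norm_triangle_ineq[of "J a (a + T) - J \<tau> (\<tau> + T)" "J \<tau> (\<tau> + T) - J 0 T"] by simp
  then show ?thesis using e1 e2 by simp
qed

lemma J_multiple_close:
  assumes K: "K \<ge> L" and ap: "\<forall>a. \<exists>\<tau>. a \<le> \<tau> \<and> \<tau> \<le> a + L \<and> (\<forall>t. norm (g (t + \<tau>) - g t) \<le> \<epsilon>)"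
  shows "norm (J 0 (real q * K) - real q *\<^sub>R J 0 K) \<le> real q * (\<epsilon> * K + 2 * B * L)"
proof (induction q)
  case 0
  then show ?case by simp
next
  case (Suc q)
  have L0: "L \<ge> 0" using ap by auto
  have K0: "K \<ge> 0" using K L0 by simp
  obtain \<tau> where tau: "real q * K \<le> \<tau>" "\<tau> \<le> real q * K + L" "\<forall>t. norm (g (t + \<tau>) - g t) \<le> \<epsilon>"
    using ap by blast
  have k1: "norm (J (real q * K) (real q * K + K) - J 0 K) \<le> \<epsilon> * K + 2 * B * L"
    using J_window_close[OF K tau(1,2)] tau(3) by blast
  have q0: "0 \<le> real q * K" using K0 by simp
  have sq: "real (Suc q) * K = real q * K + K" by (simp add: distrib_right)
  have c: "J 0 (real (Suc q) * K) = J 0 (real q * K) + J (real q * K) (real q * K + K)"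
    unfolding sq using J_split[OF q0, of "real q * K + K"] K0 by simp
  have "J 0 (real (Suc q) * K) - real (Suc q) *\<^sub>R J 0 K =
      (J 0 (real q * K) - real q *\<^sub>R J 0 K) + (J (real q * K) (real q * K + K) - J 0 K)"
    unfolding c by (simp add: algebra_simps)
  also have "norm \<dots> \<le> norm (J 0 (real q * K) - real q *\<^sub>R J 0 K) + norm (J (real q * K) (real q * K + K) - J 0 K)"
    by (rule norm_triangle_ineq)
  also have "\<dots> \<le> real q * (\<epsilon> * K + 2 * B * L) + (\<epsilon> * K + 2 * B * L)"
    using Suc.IH k1 by (rule add_mono)
  finally show ?case by (simp add: algebra_simps)
qed

abbreviation avg :: "real \<Rightarrow> 'a" where
  "avg T \<equiv> (1 / T) *\<^sub>R J 0 T"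

lemma J_nat_close:
  assumes K: "real K \<ge> L" "K \<ge> 1"
    and ap: "\<forall>a. \<exists>\<tau>. a \<le> \<tau> \<and> \<tau> \<le> a + L \<and> (\<forall>t. norm (g (t + \<tau>) - g t) \<le> \<epsilon>)"
  shows "norm (J 0 (real N) - (real N / real K) *\<^sub>R J 0 (real K))
    \<le> real (N div K) * (\<epsilon> * real K + 2 * B * L) + 2 * B * real K"
proof -
  define q where "q = N div K"
  define r where "r = N mod K"
  have Nqr: "real N = real q * real K + real r"
    unfolding q_def r_def by (metis of_nat_add of_nat_mult div_mult_mod_eq)
  have "real r \<le> real K" unfolding r_def using K(2) by simp
  have qK: "real q * real K \<le> real N" using Nqr by simp
  have rest: "norm (J (real q * real K) (real N)) \<le> B * real K"
  proof -
    have "norm (J (real q * real K) (real N)) \<le> B * (real N - real q * real K)"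
      using qK by (rule norm_J_le)
    also have "\<dots> \<le> B * real K" using Nqr \<open>real r \<le> real K\<close> bound_nonneg by (simp add: mult_left_mono)
    finally show ?thesis .
  qed
  have fraction: "norm ((real r / real K) *\<^sub>R J 0 (real K)) \<le> B * real K"
  proof -
    have "norm ((real r / real K) *\<^sub>R J 0 (real K)) = (real r / real K) * norm (J 0 (real K))"
      by simp
    also have "\<dots> \<le> 1 * (B * real K)"
      using norm_J_le[of 0 "real K"] \<open>real r \<le> real K\<close> K(2) bound_nonneg
      by (intro mult_mono) (auto simp: divide_le_eq_1)
    finally show ?thesis by simp
  qed
  have "J 0 (real N) - (real N / real K) *\<^sub>R J 0 (real K) =
      (J 0 (real q * real K) - real q *\<^sub>R J 0 (real K)) + J (real q * real K) (real N)
      - (real r / real K) *\<^sub>R J 0 (real K)"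
    using qK K(2) J_split[of 0 "real q * real K" "real N"]
    by (simp add: Nqr add_divide_distrib scaleR_add_left algebra_simps)
  also have "norm \<dots> \<le> real q * (\<epsilon> * real K + 2 * B * L) + B * real K + B * real K"
    using J_multiple_close[OF K(1) ap, of q] rest fraction
    by (meson norm_triangle_ineq norm_triangle_ineq4 add_mono order_trans)
  finally show ?thesis by (simp add: q_def)
qed

lemma avg_nat_close:
  assumes K: "real K \<ge> L" "K \<ge> 1" and N: "N \<ge> 1"
    and ap: "\<forall>a. \<exists>\<tau>. a \<le> \<tau> \<and> \<tau> \<le> a + L \<and> (\<forall>t. norm (g (t + \<tau>) - g t) \<le> \<epsilon>)"
  shows "norm (avg (real N) - avg (real K)) \<le> \<epsilon> + 2 * B * L / K + 2 * B * K / N"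
proof -
  have "L \<ge> 0" using ap by auto
  have "\<epsilon> \<ge> 0" using ap norm_ge_zero by (meson order_trans)
  have "avg (real N) - avg (real K) = (1 / real N) *\<^sub>R (J 0 (real N) - (real N / real K) *\<^sub>R J 0 (real K))"
    using N K(2) by (simp add: scaleR_diff_right)
  then have "norm (avg (real N) - avg (real K)) \<le>
      (real (N div K) * (\<epsilon> * real K + 2 * B * L) + 2 * B * real K) / real N"
    using J_nat_close[OF K ap, of N] N by (simp add: divide_right_mono)
  also have "\<dots> = (real (N div K) * real K) / real N * (\<epsilon> + 2 * B * L / real K) + 2 * B * real K / real N"
    using K(2) N by (simp add: field_simps)
  also have "\<dots> \<le> 1 * (\<epsilon> + 2 * B * L / real K) + 2 * B * real K / real N"
  proof -
    have "real (N div K) * real K \<le> real N"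
      by (metis div_times_less_eq_dividend of_nat_le_iff of_nat_mult)
    then show ?thesis
      using N \<open>\<epsilon> \<ge> 0\<close> bound_nonneg \<open>L \<ge> 0\<close> by (intro add_mono mult_right_mono) (auto simp: divide_le_eq_1)
  qed
  finally show ?thesis by simp
qed

lemma avg_floor_close:
  assumes T: "T \<ge> 1" and n: "n = nat \<lfloor>T\<rfloor>"
  shows "norm (avg T - avg (real n)) \<le> 2 * B / T"
proof -
  have fl: "\<lfloor>T\<rfloor> \<ge> 1" using T by simp
  have rn: "real n = real_of_int \<lfloor>T\<rfloor>" unfolding n using fl by simp
  have nT: "real n \<le> T" "T < real n + 1" "real n \<ge> 1" unfolding rn using fl
    by (simp_all add: of_int_floor_le real_of_int_floor_add_one_gt)
  have c: "J 0 T = J 0 (real n) + J (real n) T" using nT by (simp add: J_split)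
  have "avg T - avg (real n) = (1 / T) *\<^sub>R J (real n) T + (1 / T - 1 / real n) *\<^sub>R J 0 (real n)"
    unfolding c by (simp add: algebra_simps)
  also have "norm \<dots> \<le> norm ((1 / T) *\<^sub>R J (real n) T) + norm ((1 / T - 1 / real n) *\<^sub>R J 0 (real n))"
    by (rule norm_triangle_ineq)
  also have "\<dots> \<le> B / T + B / T"
  proof (rule add_mono)
    have "norm ((1 / T) *\<^sub>R J (real n) T) = (1 / T) * norm (J (real n) T)" using T by simp
    also have "\<dots> \<le> (1 / T) * (B * (T - real n))" using T nT by (intro mult_left_mono norm_J_le) auto
    also have "\<dots> \<le> (1 / T) * (B * 1)" using T nT bound_nonneg by (intro mult_left_mono) auto
    finally show "norm ((1 / T) *\<^sub>R J (real n) T) \<le> B / T" by simp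
  next
    have "norm ((1 / T - 1 / real n) *\<^sub>R J 0 (real n)) = \<bar>1 / T - 1 / real n\<bar> * norm (J 0 (real n))" by simp
    also have "\<dots> \<le> \<bar>1 / T - 1 / real n\<bar> * (B * real n)"
      using nT norm_J_le[of 0 "real n"] by (intro mult_left_mono) auto
    also have "\<bar>1 / T - 1 / real n\<bar> = (T - real n) / (T * real n)"
      using nT T by (simp add: field_simps abs_if)
    also have "(T - real n) / (T * real n) * (B * real n) = B * (T - real n) / T"
      using nT by (simp add: field_simps)
    also have "\<dots> \<le> B * 1 / T" using nT T bound_nonneg by (intro divide_right_mono mult_left_mono) auto
    finally show "norm ((1 / T - 1 / real n) *\<^sub>R J 0 (real n)) \<le> B / T" by simp
  qed
  finally show ?thesis by simp
qed

lemma Cauchy_avg_nat: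
  assumes "almost_periodic g"
  shows "Cauchy (\<lambda>n. avg (real n))"
proof (rule CauchyI)
  fix e :: real assume e: "e > 0"
  then obtain L where L: "\<forall>a. \<exists>\<tau>. a \<le> \<tau> \<and> \<tau> \<le> a + L \<and> (\<forall>t. norm (g (t + \<tau>) - g t) \<le> e / 8)"
    using assms unfolding almost_periodic_def dist_norm by (meson divide_pos_pos zero_less_numeral)
  have L0: "L \<ge> 0" using L by auto
  obtain K :: nat where K: "real K > max 1 (max L (16 * B * L / e))" using reals_Archimedean2 by blast
  have K1': "K \<ge> 1" using K by simp
  have KL: "real K \<ge> L" using K by simp
  have t2: "2 * B * L / real K \<le> e / 8"
  proof -
    have "16 * B * L < e * real K" using K e by (simp add: field_simps)
    then show ?thesis using K by (simp add: field_simps)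
  qed
  obtain M :: nat where M: "real M > max 1 (16 * B * real K / e)" using reals_Archimedean2 by blast
  have bnd': "norm (avg (real N) - avg (real K)) \<le> 3 * e / 8" if "N \<ge> M" for N
  proof -
    have N1: "N \<ge> 1" using M that by simp
    have t3: "2 * B * real K / real N \<le> e / 8"
    proof -
      have "real N \<ge> real M" using that by simp
      then have "e * real M \<le> e * real N" using e by (intro mult_left_mono) auto
      moreover have "16 * B * real K < e * real M" using M e by (simp add: field_simps)
      ultimately have "16 * B * real K < e * real N" by linarith
      then show ?thesis using N1 by (simp add: field_simps)
    qed
    have "norm (avg (real N) - avg (real K)) \<le> e / 8 + 2 * B * L / real K + 2 * B * real K / real N"
      by (rule avg_nat_close[OF KL K1' N1 L])
    then show ?thesis using t2 t3 by simp
  qed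
  show "\<exists>M. \<forall>m\<ge>M. \<forall>n\<ge>M. norm (avg (real m) - avg (real n)) < e"
  proof (intro exI allI impI)
    fix m n assume "m \<ge> M" "n \<ge> M"
    have "norm (avg (real m) - avg (real n)) \<le> norm (avg (real m) - avg (real K)) + norm (avg (real n) - avg (real K))"
      using norm_triangle_ineq4[of "avg (real m) - avg (real K)" "avg (real n) - avg (real K)"] by simp
    also have "\<dots> \<le> 3 * e / 8 + 3 * e / 8" using bnd' \<open>m \<ge> M\<close> \<open>n \<ge> M\<close> by (intro add_mono) auto
    finally show "norm (avg (real m) - avg (real n)) < e" using e by simp
  qed
qed

theorem has_tavg_almost_periodic:
  assumes "almost_periodic g"
  shows "\<exists>c. has_tavg g c"
proof -
  obtain c where c: "(\<lambda>n. avg (real n)) \<longlonglongrightarrow> c"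
    using Cauchy_avg_nat[OF assms] Cauchy_convergent_iff convergent_def by blast
  have "(avg \<longlongrightarrow> c) at_top"
  proof (rule tendstoI)
    fix e :: real assume e: "e > 0"
    obtain no where no: "\<forall>n\<ge>no. dist (avg (real n)) c < e / 2"
      using c e unfolding lim_sequentially by (meson half_gt_zero)
    show "\<forall>\<^sub>F T in at_top. dist (avg T) c < e"
      unfolding eventually_at_top_linorder
    proof (intro exI allI impI)
      fix T assume T: "T \<ge> max (real no) (max 1 (4 * B / e + 1))"
      define n where "n = nat \<lfloor>T\<rfloor>"
      have T1: "T \<ge> 1" using T by simp
      have "n \<ge> no" using T unfolding n_def by (simp add: le_nat_floor)
      then have d1: "dist (avg (real n)) c < e / 2" using no by blast
      have d2: "norm (avg T - avg (real n)) \<le> 2 * B / T" by (rule avg_floor_close[OF T1 n_def])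
      have "2 * B / T < e / 2"
      proof -
        have "4 * B / e < T" using T by simp
        then have "4 * B < e * T" using e by (simp add: field_simps)
        then show ?thesis using T1 by (simp add: field_simps)
      qed
      then have "dist (avg T) (avg (real n)) < e / 2" using d2 by (simp add: dist_norm)
      then show "dist (avg T) c < e" using d1 dist_triangle_half_l[of "avg T" "avg (real n)" e c]
        by (simp add: dist_commute)
    qed
  qed
  then show ?thesis unfolding has_tavg_def by (rule exI)
qed

end

lemma has_tavg_continuous_image:
  fixes p :: "real \<Rightarrow> 'a::heine_borel" and \<phi> :: "'a \<Rightarrow> 'b::euclidean_space"
  assumes ap: "almost_periodic p" and p: "continuous_on UNIV p" "bounded (range p)"
    and \<phi>: "continuous_on UNIV \<phi>"
  shows "\<exists>c. has_tavg (\<lambda>t. \<phi> (p t)) c"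
proof -
  have K: "compact (closure (range p))" using p(2) by (simp add: compact_closure)
  then have "uniformly_continuous_on (closure (range p)) \<phi>"
    by (intro compact_uniformly_continuous continuous_on_subset[OF \<phi>]) auto
  then have ap_\<phi>: "almost_periodic (\<lambda>t. \<phi> (p t))"
    by (rule almost_periodic_compose[OF ap _ closure_subset])
  have cont_\<phi>: "continuous_on UNIV (\<lambda>t. \<phi> (p t))"
    by (rule continuous_on_compose2[OF \<phi> p(1)]) auto
  have "bounded (\<phi> ` closure (range p))"
    by (intro compact_imp_bounded compact_continuous_image continuous_on_subset[OF \<phi>] K) auto
  then obtain B where B: "\<And>y. y \<in> \<phi> ` closure (range p) \<Longrightarrow> norm y \<le> B"
    unfolding bounded_iff by blast
  have "norm (\<phi> (p t)) \<le> B" for t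
    by (intro B imageI closure_subset[THEN subsetD] rangeI)
  then show ?thesis by (rule has_tavg_almost_periodic[OF cont_\<phi> _ ap_\<phi>])
qed

lemma norm_matrix_vector_mult_le:
  fixes A :: "real^'n^'m"
  shows "norm (A *v x) \<le> norm A * norm x"
proof -
  have "norm (A *v x) = L2_set (\<lambda>i. \<bar>A$i \<bullet> x\<bar>) UNIV"
    unfolding norm_vec_def[of "A *v x"] by (simp add: matrix_vector_mul_component)
  also have "\<dots> \<le> L2_set (\<lambda>i. norm (A$i) * norm x) UNIV"
    by (intro L2_set_mono Cauchy_Schwarz_ineq2) auto
  also have "\<dots> = norm A * norm x"
    unfolding norm_vec_def[of A] by (simp add: L2_set_left_distrib)
  finally show ?thesis .
qed

lemma norm_orthogonal_matrix_vector_mult: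
  fixes Q :: "real^'n^'n"
  assumes "orthogonal_matrix Q"
  shows "norm (Q *v x) = norm x"
proof -
  have "orthogonal_transformation (\<lambda>x. Q *v x)"
    using assms by (simp add: orthogonal_transformation_matrix matrix_vector_mul_linear
        matrix_of_matrix_vector_mul)
  then show ?thesis using orthogonal_transformation by blast
qed

lemma inner_orthogonal_matrix_vector_mult:
  fixes Q :: "real^'n^'n"
  assumes "orthogonal_matrix Q"
  shows "(Q *v x) \<bullet> (Q *v y) = x \<bullet> y"
proof -
  have "orthogonal_transformation (\<lambda>x. Q *v x)"
    using assms by (simp add: orthogonal_transformation_matrix matrix_vector_mul_linear
        matrix_of_matrix_vector_mul)
  then show ?thesis unfolding orthogonal_transformation_def by blast
qed

lemma norm_matrix_mult_orthogonal:
  fixes A :: "real^'n^'m" and Q :: "real^'n^'n"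
  assumes "orthogonal_matrix Q"
  shows "norm (A ** Q) = norm A"
proof -
  have "norm ((A ** Q) $ i) = norm (A $ i)" for i
  proof -
    have "(A ** Q) $ i = transpose Q *v (A $ i)"
      by (simp add: vec_eq_iff matrix_matrix_mult_def matrix_vector_mult_def transpose_def
          mult.commute)
    then show ?thesis
      by (simp only: norm_orthogonal_matrix_vector_mult orthogonal_matrix_transpose assms)
  qed
  then show ?thesis unfolding norm_vec_def[of "A ** Q"] norm_vec_def[of A] by simp
qed

lemma matrix_diff_rdistrib: "(A - B) ** C = A ** C - B ** (C :: 'a::ring_1^'n^'k)"
  by (simp add: vec_eq_iff matrix_matrix_mult_def left_diff_distrib sum_subtractf)

section \<open>Simultaneous recurrence\<close>

lemma finite_net:
  fixes g :: "'a \<Rightarrow> 'b::heine_borel"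
  assumes "bounded (g ` A)" "e > 0"
  obtains S where "finite S" "S \<subseteq> A" "\<And>t. t \<in> A \<Longrightarrow> \<exists>s\<in>S. dist (g t) (g s) < e"
proof -
  have "Met_TC.mtotally_bounded (closure (g ` A))"
    using assms(1) by (intro Met_TC.compactin_imp_mtotally_bounded) (simp add: compact_closure)
  then have "Met_TC.mtotally_bounded (g ` A)"
    using closure_subset by (rule Met_TC.mtotally_bounded_subset)
  then obtain K where K: "finite K" "K \<subseteq> g ` A" "g ` A \<subseteq> (\<Union>x\<in>K. ball x e)"
    using assms(2) unfolding Met_TC.mtotally_bounded_def by force
  then obtain S where S: "S \<subseteq> A" "finite S" "K = g ` S"
    by (meson finite_subset_image)
  have "\<exists>s\<in>S. dist (g t) (g s) < e" if "t \<in> A" for t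
    using K(3) that unfolding S(3) by (fastforce simp: dist_commute)
  then show ?thesis using that S by blast
qed

text \<open>Induction on \<open>n\<close>: refine a net for the first \<open>n\<close> functions inside each of its cells.\<close>

lemma simultaneous_finite_net:
  fixes E :: "real \<Rightarrow> 'a::heine_borel" and g :: "nat \<Rightarrow> real \<Rightarrow> 'b::heine_borel"
  assumes E: "bounded (range E)" and g: "\<And>k. bounded (range (g k))"
  shows "\<delta> > 0 \<Longrightarrow> \<exists>S. finite S \<and>
    (\<forall>t. \<exists>s\<in>S. dist (E t) (E s) < \<delta> \<and> (\<forall>k<n. dist (g k t) (g k s) < \<delta>))"
proof (induction n arbitrary: \<delta>)
  case 0
  obtain S where "finite S" "S \<subseteq> UNIV" "\<And>t. t \<in> UNIV \<Longrightarrow> \<exists>s\<in>S. dist (E t) (E s) < \<delta>"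
    by (rule finite_net[OF E 0]) blast
  then show ?case by auto
next
  case (Suc n)
  define close where "close t s \<longleftrightarrow> dist (E t) (E s) < \<delta> / 2 \<and> (\<forall>k<n. dist (g k t) (g k s) < \<delta> / 2)"
    for t s
  have "\<exists>S. finite S \<and> (\<forall>t. \<exists>s\<in>S. close t s)"
    using Suc.IH[of "\<delta> / 2"] Suc.prems unfolding close_def by simp
  then obtain S where S: "finite S" "\<forall>t. \<exists>s\<in>S. close t s" by blast
  have "\<forall>s. \<exists>F. finite F \<and> F \<subseteq> {t. close t s} \<and> (\<forall>t\<in>{t. close t s}. \<exists>t'\<in>F. dist (g n t) (g n t') < \<delta>)"
  proof
    fix s
    have bounded_cell: "bounded (g n ` {t. close t s})" using g[of n] by (rule bounded_subset) auto
    obtain F where "finite F" "F \<subseteq> {t. close t s}"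
      "\<And>t. t \<in> {t. close t s} \<Longrightarrow> \<exists>t'\<in>F. dist (g n t) (g n t') < \<delta>"
      by (rule finite_net[OF bounded_cell Suc.prems]) blast
    then show "\<exists>F. finite F \<and> F \<subseteq> {t. close t s} \<and> (\<forall>t\<in>{t. close t s}. \<exists>t'\<in>F. dist (g n t) (g n t') < \<delta>)"
      by blast
  qed
  then obtain F where F: "\<forall>s. finite (F s) \<and> F s \<subseteq> {t. close t s} \<and>
      (\<forall>t\<in>{t. close t s}. \<exists>t'\<in>F s. dist (g n t) (g n t') < \<delta>)"
    by (rule choice[THEN exE])
  have "\<exists>t'\<in>(\<Union>s\<in>S. F s). dist (E t) (E t') < \<delta> \<and> (\<forall>k<Suc n. dist (g k t) (g k t') < \<delta>)" for t
  proof -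
    obtain s where "s \<in> S" "close t s" using S(2) by blast
    then obtain t' where t': "t' \<in> F s" "dist (g n t) (g n t') < \<delta>" using F by blast
    then have "close t' s" using F by blast
    have "dist (E t) (E t') < \<delta>"
      using \<open>close t s\<close> \<open>close t' s\<close> unfolding close_def by (metis dist_triangle_half_l)
    moreover have "dist (g k t) (g k t') < \<delta>" if "k < n" for k
      using \<open>close t s\<close> \<open>close t' s\<close> that unfolding close_def by (metis dist_triangle_half_l)
    ultimately have "dist (E t) (E t') < \<delta>" "\<forall>k<n. dist (g k t) (g k t') < \<delta>" by auto
    then show ?thesis using t' \<open>s \<in> S\<close> less_Suc_eq by auto
  qed
  then show ?case using S(1) F by blast
qed

lemma cis_close_to_one:
  assumes "\<epsilon> > 0"
  obtains \<eta> where "\<eta> > 0" "\<And>x. cmod (cis x - 1) < \<eta> \<Longrightarrow> \<exists>m::int. \<bar>x - 2 * pi * of_int m\<bar> \<le> \<epsilon>"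
proof -
  define e where "e = min \<epsilon> (pi / 2)"
  have e: "e > 0" "e \<le> \<epsilon>" "e < pi" using assms pi_gt_zero unfolding e_def by linarith+
  have "cos e < cos 0" using e by (intro cos_monotone_0_pi) auto
  moreover have "\<exists>m::int. \<bar>x - 2 * pi * of_int m\<bar> \<le> \<epsilon>" if x: "cmod (cis x - 1) < 1 - cos e" for x
  proof -
    define m where "m = \<lfloor>x / (2 * pi) + 1 / 2\<rfloor>"
    define y where "y = x - 2 * pi * of_int m"
    have "of_int m \<le> x / (2 * pi) + 1 / 2" "x / (2 * pi) + 1 / 2 < of_int m + 1"
      unfolding m_def by linarith+
    then have "\<bar>y\<bar> \<le> pi" unfolding y_def using pi_gt_zero by (simp add: field_simps abs_le_iff)
    have "cos x = cos y"
      using sin_cos_eq_iff[of x y] by (auto simp: y_def)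
    moreover have "1 - cos x \<le> cmod (cis x - 1)"
      using abs_Re_le_cmod[of "cis x - 1"] by simp
    ultimately have "cos e < cos \<bar>y\<bar>" using x by simp
    then have "\<bar>y\<bar> \<le> e"
      using cos_monotone_0_pi[of e "\<bar>y\<bar>"] \<open>\<bar>y\<bar> \<le> pi\<close> e by fastforce
    then show ?thesis using e unfolding y_def by (intro exI[of _ m]) linarith
  qed
  ultimately show ?thesis using that[of "1 - cos e"] by simp
qed

lemma dist_cis_shift: "dist (cis (c * (\<tau> + s))) (cis (c * s)) = cmod (cis (c * \<tau>) - 1)"
proof -
  have "cis (c * (\<tau> + s)) - cis (c * s) = (cis (c * \<tau>) - 1) * cis (c * s)"
    by (simp add: distrib_left cis_mult[symmetric] algebra_simps)
  then show ?thesis by (simp add: dist_norm norm_mult)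
qed

lemma orthogonal_group_dist_shift:
  fixes E :: "real \<Rightarrow> real^'n^'n"
  assumes add: "\<And>s t. E (s + t) = E s ** E t" and orth: "\<And>t. orthogonal_matrix (E t)"
  shows "dist (E (\<tau> + s)) (E s) = dist (E \<tau>) (mat 1)"
proof -
  have "E (\<tau> + s) - E s = (E \<tau> - mat 1) ** E s" by (simp add: add matrix_diff_rdistrib)
  then show ?thesis by (simp add: dist_norm norm_matrix_mult_orthogonal[OF orth])
qed

lemma bounded_range_orthogonal_matrix:
  fixes E :: "real \<Rightarrow> real^'n^'n"
  assumes "\<And>t. orthogonal_matrix (E t)"
  shows "bounded (range E)"
proof -
  have "norm (E t) = norm (mat 1 :: real^'n^'n)" for t
    using norm_matrix_mult_orthogonal[OF assms, of "mat 1" t] by simp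
  then show ?thesis by (intro boundedI[of _ "norm (mat 1 :: real^'n^'n)"]) auto
qed

lemma orthogonal_group_dist_shift_apply:
  fixes E :: "real \<Rightarrow> real^'n^'n"
  assumes add: "\<And>s t. E (s + t) = E s ** E t" and orth: "\<And>t. orthogonal_matrix (E t)"
  shows "dist (E (\<tau> + s) *v x) (E s *v x) \<le> dist (E \<tau>) (mat 1) * norm x"
proof -
  have "dist (E (\<tau> + s) *v x) (E s *v x) = norm ((E \<tau> - mat 1) *v (E s *v x))"
    by (simp add: add dist_norm matrix_vector_mul_assoc matrix_diff_rdistrib
        matrix_vector_mult_diff_rdistrib)
  also have "\<dots> \<le> dist (E \<tau>) (mat 1) * norm x"
    using norm_matrix_vector_mult_le[of "E \<tau> - mat 1" "E s *v x"]
    by (simp add: dist_norm norm_orthogonal_matrix_vector_mult[OF orth])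
  finally show ?thesis .
qed

text \<open>The return times are differences \<open>t - s\<close> of nearby points of a finite net of the bounded
  curve \<open>t \<mapsto> (E t, cis (2\<pi>\<nu>\<^sub>0 t), \<dots>, cis (2\<pi>\<nu>\<^sub>n\<^sub>-\<^sub>1 t))\<close>, with \<open>t\<close> taken in the middle of the window.\<close>

lemma orthogonal_group_recurrence:
  fixes E :: "real \<Rightarrow> real^'n^'n" and \<nu> :: "nat \<Rightarrow> real"
  assumes add: "\<And>s t. E (s + t) = E s ** E t" and orth: "\<And>t. orthogonal_matrix (E t)"
    and "\<delta> > 0"
  obtains L where "\<And>a. \<exists>\<tau>. a \<le> \<tau> \<and> \<tau> \<le> a + L \<and> dist (E \<tau>) (mat 1) < \<delta> \<and>
    (\<forall>k<n. \<exists>m::int. \<bar>\<nu> k * \<tau> - of_int m\<bar> \<le> \<delta>)"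
proof -
  obtain \<eta> where "\<eta> > 0"
    and \<eta>: "\<And>x. cmod (cis x - 1) < \<eta> \<Longrightarrow> \<exists>m::int. \<bar>x - 2 * pi * of_int m\<bar> \<le> 2 * pi * \<delta>"
    using cis_close_to_one[of "2 * pi * \<delta>"] \<open>\<delta> > 0\<close> by auto
  define phase where "phase k t = cis ((2 * pi * \<nu> k) * t)" for k t
  have bounded_phase: "bounded (range (phase k))" for k
    by (rule boundedI[where B = 1]) (auto simp: phase_def)
  obtain S where S: "finite S"
    "\<forall>t. \<exists>s\<in>S. dist (E t) (E s) < min \<delta> \<eta> \<and> (\<forall>k<n. dist (phase k t) (phase k s) < min \<delta> \<eta>)"
    using simultaneous_finite_net[where E = E and g = phase and \<delta> = "min \<delta> \<eta>" and n = n,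
        OF bounded_range_orthogonal_matrix[OF orth] bounded_phase] \<open>\<delta> > 0\<close> \<open>\<eta> > 0\<close>
    by auto
  define M where "M = Max (abs ` S)"
  have S_bound: "\<bar>s\<bar> \<le> M" if "s \<in> S" for s using S(1) that unfolding M_def by (intro Max_ge) auto
  have "\<exists>\<tau>. a \<le> \<tau> \<and> \<tau> \<le> a + 2 * M \<and> dist (E \<tau>) (mat 1) < \<delta> \<and>
    (\<forall>k<n. \<exists>m::int. \<bar>\<nu> k * \<tau> - of_int m\<bar> \<le> \<delta>)" for a
  proof -
    obtain s where s: "s \<in> S" "dist (E (a + M)) (E s) < min \<delta> \<eta>"
      "\<forall>k<n. dist (phase k (a + M)) (phase k s) < min \<delta> \<eta>"
      using S(2) by blast
    define \<tau> where "\<tau> = a + M - s"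
    have "a + M = \<tau> + s" by (simp add: \<tau>_def)
    have "a \<le> \<tau>" "\<tau> \<le> a + 2 * M" using S_bound[OF s(1)] unfolding \<tau>_def by linarith+
    moreover have "dist (E \<tau>) (mat 1) < \<delta>"
      using s(2) orthogonal_group_dist_shift[OF add orth, of \<tau> s] \<open>a + M = \<tau> + s\<close> by simp
    moreover have "\<exists>m::int. \<bar>\<nu> k * \<tau> - of_int m\<bar> \<le> \<delta>" if k: "k < n" for k
    proof -
      have "cmod (cis (2 * pi * \<nu> k * \<tau>) - 1) < \<eta>"
        using s(3) k \<open>a + M = \<tau> + s\<close> by (simp add: phase_def dist_cis_shift)
      then obtain m :: int where "\<bar>2 * pi * \<nu> k * \<tau> - 2 * pi * of_int m\<bar> \<le> 2 * pi * \<delta>"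
        using \<eta> by blast
      then have "2 * pi * \<bar>\<nu> k * \<tau> - of_int m\<bar> \<le> 2 * pi * \<delta>"
        by (simp add: abs_mult right_diff_distrib[symmetric] mult.assoc)
      then show ?thesis by auto
    qed
    ultimately show ?thesis by blast
  qed
  then show ?thesis by (rule that)
qed

section \<open>Quasiperiodic functions along an orthogonal flow\<close>

lemma periodic_integer_shift:
  fixes \<phi> :: "(nat \<Rightarrow> real) \<Rightarrow> 'z"
  assumes per: "\<And>\<theta>. \<phi> (\<theta>(i := \<theta> i + 1)) = \<phi> \<theta>"
  shows "\<phi> (\<theta>(i := \<theta> i + of_int m)) = \<phi> \<theta>"
proof -
  have nat_shift: "\<phi> (\<theta>(i := \<theta> i + real k)) = \<phi> \<theta>" for k :: nat and \<theta>
  proof (induction k)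
    case (Suc k)
    have "\<theta>(i := \<theta> i + real (Suc k)) = (\<theta>(i := \<theta> i + real k))(i := (\<theta>(i := \<theta> i + real k)) i + 1)"
      by (rule ext) simp
    then show ?case using per Suc.IH by metis
  qed simp
  show ?thesis
  proof (cases "m \<ge> 0")
    case True
    then show ?thesis using nat_shift[of \<theta> "nat m"] by simp
  next
    case False
    define \<theta>' where "\<theta>' = \<theta>(i := \<theta> i + of_int m)"
    have "\<theta>'(i := \<theta>' i + real (nat (-m))) = \<theta>" using False unfolding \<theta>'_def by (intro ext) simp
    then show ?thesis using nat_shift[of \<theta>' "nat (-m)"] unfolding \<theta>'_def by simp
  qed
qed

lemma periodic_integer_shifts:
  fixes \<phi> :: "(nat \<Rightarrow> real) \<Rightarrow> 'z"
  assumes per: "\<And>\<theta> i. i < n \<Longrightarrow> \<phi> (\<theta>(i := \<theta> i + 1)) = \<phi> \<theta>"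
    and shift: "\<forall>i<n. \<exists>m::int. \<theta>' i = \<theta> i + of_int m" and same: "\<forall>i\<ge>n. \<theta>' i = \<theta> i"
  shows "\<phi> \<theta>' = \<phi> \<theta>"
proof -
  define mix where "mix j = (\<lambda>i. if i < j then \<theta>' i else \<theta> i)" for j
  have "j \<le> n \<Longrightarrow> \<phi> (mix j) = \<phi> \<theta>" for j
  proof (induction j)
    case (Suc j)
    obtain m :: int where m: "\<theta>' j = \<theta> j + of_int m" using shift Suc.prems Suc_le_eq by blast
    have "mix (Suc j) = (mix j)(j := mix j j + of_int m)" by (auto simp: mix_def fun_eq_iff m)
    then have "\<phi> (mix (Suc j)) = \<phi> (mix j)"
      using periodic_integer_shift[of \<phi> j] per Suc.prems by simp
    then show ?case using Suc by simp
  qed (simp add: mix_def)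
  moreover have "mix n = \<theta>'" using same by (auto simp: mix_def fun_eq_iff)
  ultimately show ?thesis by auto
qed

lemma dist_fun_le_uniform:
  fixes \<theta> \<theta>' :: "nat \<Rightarrow> real"
  assumes "\<forall>i. \<bar>\<theta> i - \<theta>' i\<bar> \<le> \<eta>"
  shows "dist \<theta> \<theta>' \<le> 2 * \<eta>"
proof -
  have le: "(1/2)^k * min (dist (\<theta> (from_nat k)) (\<theta>' (from_nat k))) 1 \<le> (1/2)^k * \<eta>" for k
    using assms by (intro mult_left_mono) (auto simp: dist_real_def min_le_iff_disj)
  have sg: "summable (\<lambda>k. (1/2::real)^k * \<eta>)" by (intro summable_mult2 summable_geometric) simp
  have sf: "summable (\<lambda>k. (1/2::real)^k * min (dist (\<theta> (from_nat k)) (\<theta>' (from_nat k))) 1)"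
    by (rule summable_comparison_test'[OF sg, of 0]) (use le in auto)
  have "dist \<theta> \<theta>' = (\<Sum>k. (1/2)^k * min (dist (\<theta> (from_nat k)) (\<theta>' (from_nat k))) 1)"
    by (simp add: dist_fun_def)
  also have "\<dots> \<le> (\<Sum>k. (1/2::real)^k * \<eta>)" by (rule suminf_le[OF le sf sg])
  also have "\<dots> = 2 * \<eta>" using suminf_geometric[of "1/2::real"] by (simp add: suminf_mult2[OF summable_geometric, symmetric])
  finally show ?thesis .
qed

lemma compact_PiE_box:
  "compact (Pi\<^sub>E UNIV (\<lambda>i::nat. if i < n then {-1..2::real} else {0}))"
proof -
  have "compactin (product_topology (\<lambda>i. euclidean) UNIV) (Pi\<^sub>E UNIV (\<lambda>i::nat. if i < n then {-1..2::real} else {0}))"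
    unfolding compactin_PiE by auto
  then show ?thesis by (simp add: euclidean_product_topology)
qed


lemma phases_in_box:
  assumes "\<forall>i<n. \<bar>b i\<bar> \<le> 1/2"
  shows "(\<lambda>i. if i < n then frac (a i) + b i else 0) \<in> (\<Pi>\<^sub>E i\<in>UNIV. if i < n then {-1..2::real} else {0})"
proof -
  have "-1 \<le> frac (a i) + b i \<and> frac (a i) + b i \<le> 2" if "i < n" for i
  proof -
    have "\<bar>b i\<bar> \<le> 1/2" using assms that by blast
    then show ?thesis using frac_lt_1[of "a i"] frac_ge_0[of "a i"] unfolding abs_le_iff by linarith
  qed
  then show ?thesis by auto
qed

context
  fixes Fh :: "'a::euclidean_space \<Rightarrow> (nat \<Rightarrow> real) \<Rightarrow> 'b::metric_space"
    and F :: "'a \<Rightarrow> real \<Rightarrow> 'b" and n :: nat and \<nu> :: "nat \<Rightarrow> real"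
  assumes Fh_cont: "continuous_on UNIV (\<lambda>(y, \<theta>). Fh y \<theta>)"
    and Fh_periodic: "\<forall>y \<theta> i. i < n \<longrightarrow> Fh y (\<theta>(i := \<theta> i + 1)) = Fh y \<theta>"
    and F_eq: "\<forall>y t. F y t = Fh y (\<lambda>i. if i < n then \<nu> i * t else 0)"
begin

lemma quasiperiodic_phase_shift:
  assumes "\<forall>i<n. \<exists>m::int. \<nu> i * t = \<theta> i + of_int m" "\<forall>i\<ge>n. \<theta> i = 0"
  shows "F y t = Fh y \<theta>"
  unfolding F_eq[rule_format]
  by (rule periodic_integer_shifts[where \<phi> = "Fh y" and n = n]) (use Fh_periodic assms in auto)

text \<open>The phases of \<open>F y t\<close> can be reduced to the compact box \<open>[-1, 2]\<^sup>n\<close>, on which \<open>Fh\<close> is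
  uniformly continuous; a shift by \<open>\<tau>\<close> with \<open>\<nu>\<^sub>k \<tau>\<close> close to integers moves the phases only a little.\<close>

lemma quasiperiodic_uniform_shift:
  assumes "\<epsilon> > 0"
  obtains \<delta> where "\<delta> > 0" "\<And>y y' t \<tau>. norm y \<le> R \<Longrightarrow> norm y' \<le> R \<Longrightarrow> dist y' y \<le> \<delta> \<Longrightarrow>
    (\<forall>k<n. \<exists>m::int. \<bar>\<nu> k * \<tau> - of_int m\<bar> \<le> \<delta>) \<Longrightarrow> dist (F y' (t + \<tau>)) (F y t) < \<epsilon>"
proof -
  define K where "K = Pi\<^sub>E UNIV (\<lambda>i::nat. if i < n then {-1..2::real} else {0})"
  have "compact (cball (0::'a) R \<times> K)"
    unfolding K_def by (intro compact_Times compact_cball compact_PiE_box)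
  then have "uniformly_continuous_on (cball (0::'a) R \<times> K) (\<lambda>(y, \<theta>). Fh y \<theta>)"
    by (intro compact_uniformly_continuous continuous_on_subset[OF Fh_cont]) auto
  then obtain d where "d > 0" and d: "\<And>p p'. p \<in> cball 0 R \<times> K \<Longrightarrow> p' \<in> cball 0 R \<times> K \<Longrightarrow>
      dist p' p < d \<Longrightarrow> dist ((\<lambda>(y, \<theta>). Fh y \<theta>) p') ((\<lambda>(y, \<theta>). Fh y \<theta>) p) < \<epsilon>"
    unfolding uniformly_continuous_on_def using assms by metis
  define \<delta> where "\<delta> = min (1/2) (d / 4)"
  have "\<delta> > 0" "\<delta> \<le> 1/2" "\<delta> \<le> d / 4" using \<open>d > 0\<close> by (simp_all add: \<delta>_def)
  moreover have "dist (F y' (t + \<tau>)) (F y t) < \<epsilon>"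
    if y: "norm y \<le> R" "norm y' \<le> R" "dist y' y \<le> \<delta>"
      and \<tau>: "\<forall>k<n. \<exists>m::int. \<bar>\<nu> k * \<tau> - of_int m\<bar> \<le> \<delta>" for y y' t \<tau>
  proof -
    obtain m :: "nat \<Rightarrow> int" where m: "\<forall>k<n. \<bar>\<nu> k * \<tau> - of_int (m k)\<bar> \<le> \<delta>"
      using \<tau> by metis
    define r where "r = (\<lambda>i. if i < n then frac (\<nu> i * t) else 0)"
    define r' where "r' = (\<lambda>i. if i < n then frac (\<nu> i * t) + (\<nu> i * \<tau> - of_int (m i)) else 0)"
    have "F y t = Fh y r"
      by (rule quasiperiodic_phase_shift) (auto simp: r_def frac_def)
    moreover have "F y' (t + \<tau>) = Fh y' r'"
    proof (rule quasiperiodic_phase_shift)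
      show "\<forall>i<n. \<exists>k::int. \<nu> i * (t + \<tau>) = r' i + of_int k"
        by (intro allI impI exI[of _ "\<lfloor>\<nu> _ * t\<rfloor> + m _"]) (simp add: r'_def frac_def algebra_simps)
    qed (simp add: r'_def)
    moreover have "r \<in> K"
      using phases_in_box[of n "\<lambda>_. 0" "\<lambda>i. \<nu> i * t"] unfolding K_def r_def
      by (simp only: add_0_right) simp
    moreover have "\<forall>i<n. \<bar>\<nu> i * \<tau> - of_int (m i)\<bar> \<le> 1/2"
      using m \<open>\<delta> \<le> 1/2\<close> by (auto intro: order_trans)
    then have "r' \<in> K"
      using phases_in_box[of n "\<lambda>i. \<nu> i * \<tau> - of_int (m i)" "\<lambda>i. \<nu> i * t"]
      unfolding K_def r'_def by simp
    moreover have "dist r' r \<le> 2 * \<delta>"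
      by (rule dist_fun_le_uniform) (use m \<open>\<delta> > 0\<close> in \<open>auto simp: r_def r'_def\<close>)
    then have "dist y' y + dist r' r < d" using y(3) \<open>\<delta> \<le> d / 4\<close> \<open>d > 0\<close> by linarith
    then have "dist (y', r') (y, r) < d"
      using sqrt_sum_squares_le_sum_abs[of "dist y' y" "dist r' r"] unfolding dist_Pair_Pair by simp
    ultimately show ?thesis using d[of "(y, r)" "(y', r')"] y(1,2) by simp
  qed
  ultimately show ?thesis using that by blast
qed

end

lemma almost_periodic_orthogonal_frame:
  fixes E :: "real \<Rightarrow> real^'d^'d" and F :: "real^'d \<Rightarrow> real \<Rightarrow> real^'d"
    and Fh :: "real^'d \<Rightarrow> (nat \<Rightarrow> real) \<Rightarrow> real^'d"
  assumes add: "\<And>s t. E (s + t) = E s ** E t" and orth: "\<And>t. orthogonal_matrix (E t)"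
    and Fh_cont: "continuous_on UNIV (\<lambda>(y, \<theta>). Fh y \<theta>)"
    and Fh_periodic: "\<forall>y \<theta> i. i < n \<longrightarrow> Fh y (\<theta>(i := \<theta> i + 1)) = Fh y \<theta>"
    and F_eq: "\<forall>y t. F y t = Fh y (\<lambda>i. if i < n then \<nu> i * t else 0)"
  shows "almost_periodic (\<lambda>t. (E t, F (E t *v x) t))"
  unfolding almost_periodic_def
proof (intro allI impI)
  fix \<epsilon> :: real assume "\<epsilon> > 0"
  obtain \<delta> where "\<delta> > 0" and F_close: "\<And>y y' t \<tau>. norm y \<le> norm x \<Longrightarrow> norm y' \<le> norm x \<Longrightarrow>
      dist y' y \<le> \<delta> \<Longrightarrow> (\<forall>k<n. \<exists>m::int. \<bar>\<nu> k * \<tau> - of_int m\<bar> \<le> \<delta>) \<Longrightarrow>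
      dist (F y' (t + \<tau>)) (F y t) < \<epsilon> / 2"
    using quasiperiodic_uniform_shift[OF Fh_cont Fh_periodic F_eq, of "\<epsilon> / 2" "norm x"] \<open>\<epsilon> > 0\<close>
    by auto
  define \<delta>' where "\<delta>' = min (\<epsilon> / 2) (\<delta> / (norm x + 1))"
  have "norm x + 1 > 0" using norm_ge_zero[of x] by linarith
  then have "\<delta>' > 0" using \<open>\<epsilon> > 0\<close> \<open>\<delta> > 0\<close> by (simp add: \<delta>'_def)
  have "\<delta>' \<le> \<delta> / (norm x + 1)" by (simp add: \<delta>'_def)
  then have "\<delta>' * norm x \<le> \<delta> / (norm x + 1) * (norm x + 1)"
    using \<open>\<delta>' > 0\<close> by (intro mult_mono) auto
  then have "\<delta>' * norm x \<le> \<delta>" using \<open>norm x + 1 > 0\<close> by simp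
  have "\<delta>' \<le> \<epsilon> / 2" unfolding \<delta>'_def by (rule min.cobounded1)
  have "\<delta> / (norm x + 1) \<le> \<delta> / 1" using \<open>\<delta> > 0\<close> \<open>norm x + 1 > 0\<close> by (intro divide_left_mono) auto
  then have "\<delta>' \<le> \<delta>" using \<open>\<delta>' \<le> \<delta> / (norm x + 1)\<close> by simp
  obtain L where L: "\<And>a. \<exists>\<tau>. a \<le> \<tau> \<and> \<tau> \<le> a + L \<and> dist (E \<tau>) (mat 1) < \<delta>' \<and>
      (\<forall>k<n. \<exists>m::int. \<bar>\<nu> k * \<tau> - of_int m\<bar> \<le> \<delta>')"
    using orthogonal_group_recurrence[OF add orth \<open>\<delta>' > 0\<close>] by blast
  have "dist (E (\<tau> + t), F (E (\<tau> + t) *v x) (\<tau> + t)) (E t, F (E t *v x) t) \<le> \<epsilon>"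
    if \<tau>: "dist (E \<tau>) (mat 1) < \<delta>'" "\<forall>k<n. \<exists>m::int. \<bar>\<nu> k * \<tau> - of_int m\<bar> \<le> \<delta>'" for t \<tau>
  proof -
    have "dist (F (E (\<tau> + t) *v x) (t + \<tau>)) (F (E t *v x) t) < \<epsilon> / 2"
    proof (rule F_close)
      have "dist (E (\<tau> + t) *v x) (E t *v x) \<le> \<delta>' * norm x"
        using orthogonal_group_dist_shift_apply[OF add orth, of \<tau> t x] \<tau>(1)
        by (meson less_imp_le mult_right_mono norm_ge_zero order_trans)
      then show "dist (E (\<tau> + t) *v x) (E t *v x) \<le> \<delta>" using \<open>\<delta>' * norm x \<le> \<delta>\<close> by simp
      show "\<forall>k<n. \<exists>m::int. \<bar>\<nu> k * \<tau> - of_int m\<bar> \<le> \<delta>"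
        using \<tau>(2) \<open>\<delta>' \<le> \<delta>\<close> by (meson order_trans)
    qed (simp_all add: norm_orthogonal_matrix_vector_mult[OF orth])
    moreover have "dist (E (\<tau> + t)) (E t) < \<epsilon> / 2"
      using orthogonal_group_dist_shift[OF add orth] \<tau>(1) \<open>\<delta>' \<le> \<epsilon> / 2\<close> by simp
    ultimately show ?thesis
      using sqrt_sum_squares_le_sum_abs[of "dist (E (\<tau> + t)) (E t)"
          "dist (F (E (\<tau> + t) *v x) (\<tau> + t)) (F (E t *v x) t)"]
      unfolding dist_Pair_Pair abs_of_nonneg[OF zero_le_dist] by (simp add: add.commute)
  qed
  then show "\<exists>L. \<forall>a. \<exists>\<tau>. a \<le> \<tau> \<and> \<tau> \<le> a + L \<and>
      (\<forall>t. dist (E (t + \<tau>), F (E (t + \<tau>) *v x) (t + \<tau>)) (E t, F (E t *v x) t) \<le> \<epsilon>)"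
    using L by (metis add.commute)
qed

section \<open>The rotating frame\<close>

lemma skew_inner:
  fixes \<Omega> :: "real^'n^'n"
  assumes "transpose \<Omega> = - \<Omega>"
  shows "(\<Omega> *v a) \<bullet> b = - (a \<bullet> (\<Omega> *v b))"
proof -
  have "(\<Omega> *v a) \<bullet> b = a \<bullet> (transpose \<Omega> *v b)"
    by (metis dot_lmul_matrix vector_transpose_matrix)
  also have "transpose \<Omega> *v b = - (\<Omega> *v b)"
    unfolding assms by (simp add: vec_eq_iff matrix_vector_mult_def sum_negf)
  finally show ?thesis by simp
qed

text \<open>\<open>\<Omega> (omega_hat_inv \<Omega>) c\<close> is the orthogonal projection of \<open>c\<close> onto the range of \<open>\<Omega>\<close>:
  the remainder lies in the kernel of \<open>\<Omega>\<close>, which is orthogonal to the range since \<open>\<Omega>\<close> is skew.\<close>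

lemma skew_omega_hat_inv_projection:
  fixes \<Omega> :: "real^'n^'n" and c :: "real^'n"
  assumes skew: "transpose \<Omega> = - \<Omega>"
  defines "v \<equiv> \<Omega> *v (omega_hat_inv \<Omega> *v c)"
  shows "v \<bullet> c = v \<bullet> v"
proof -
  have "\<Omega> *v v = (\<Omega> ** \<Omega> ** omega_hat_inv \<Omega>) *v c"
    by (simp add: v_def matrix_vector_mul_assoc matrix_mul_assoc)
  then have "\<Omega> *v v = \<Omega> *v c" by (simp add: skew_mult_omega_hat_inv[OF skew])
  then have "v \<bullet> (c - v) = 0"
    unfolding v_def skew_inner[OF skew] by (simp add: matrix_vector_mult_diff_distrib)
  then show ?thesis by (simp add: inner_diff_right)
qed

lemma mexp_uminus:
  assumes skew: "transpose \<Omega> = - \<Omega>"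
  shows "mexp \<Omega> (- t) = transpose (mexp \<Omega> t)"
proof -
  have "mexp \<Omega> (- t) = mexp \<Omega> (- t) ** (mexp \<Omega> t ** transpose (mexp \<Omega> t))"
    using orthogonal_matrix_mexp[OF skew] by (simp add: orthogonal_matrix_def)
  also have "\<dots> = (mexp \<Omega> (- t) ** mexp \<Omega> t) ** transpose (mexp \<Omega> t)"
    by (simp only: matrix_mul_assoc)
  also have "mexp \<Omega> (- t) ** mexp \<Omega> t = mat 1"
    using mexp_add[OF skew, of "- t" t] mexp_zero[OF skew] by simp
  finally show ?thesis by simp
qed

text \<open>A vector in the range of \<open>\<Omega>\<close> has a bounded primitive along the flow, so its rotating average
  vanishes.\<close>

lemma has_tavg_mexp_uminus_range:
  assumes skew: "transpose \<Omega> = - \<Omega>"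
  shows "has_tavg (\<lambda>t. mexp \<Omega> (- t) *v (\<Omega> *v w)) 0"
proof (rule has_tavg_zero_if_bounded_integral)
  fix T :: real assume "T \<ge> 0"
  have "((\<lambda>t. mexp \<Omega> (- t) *v (\<Omega> *v w)) has_integral (w - mexp \<Omega> (- T) *v w)) {0..T}"
  proof -
    have "((\<lambda>s. - (mexp \<Omega> (- s) *v w)) has_vector_derivative - (- (mexp \<Omega> (- t) *v (\<Omega> *v w))))
        (at t)" for t
      by (rule has_vector_derivative_minus[OF has_vector_derivative_mexp_uminus[OF skew]])
    then have "((\<lambda>s. - (mexp \<Omega> (- s) *v w)) has_vector_derivative mexp \<Omega> (- t) *v (\<Omega> *v w))
        (at t within {0..T})" for t
      by (simp add: has_vector_derivative_at_within)
    from fundamental_theorem_of_calculus[OF \<open>T \<ge> 0\<close> this] show ?thesis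
      by (simp add: mexp_zero[OF skew])
  qed
  then have "norm (integral {0..T} (\<lambda>t. mexp \<Omega> (- t) *v (\<Omega> *v w))) \<le> norm w + norm (mexp \<Omega> (- T) *v w)"
    by (simp add: integral_unique norm_triangle_ineq4)
  then show "norm (integral {0..T} (\<lambda>t. mexp \<Omega> (- t) *v (\<Omega> *v w))) \<le> 2 * norm w"
    by (simp add: norm_orthogonal_matrix_vector_mult[OF orthogonal_matrix_mexp[OF skew]])
qed

lemma tnorm_pythagoras:
  fixes a b :: "real \<Rightarrow> real^'n"
  assumes cont: "continuous_on UNIV a" "continuous_on UNIV b"
    and ab: "has_tavg (\<lambda>t. a t \<bullet> b t) 0"
    and aa: "has_tavg (\<lambda>t. a t \<bullet> a t) A" and bb: "has_tavg (\<lambda>t. b t \<bullet> b t) B"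
  shows "(tnorm (\<lambda>t. a t + b t))\<^sup>2 = (tnorm b)\<^sup>2 + (tnorm a)\<^sup>2"
    and "tnorm b \<le> tnorm (\<lambda>t. a t + b t)"
proof -
  have "has_tavg (\<lambda>t. (a t \<bullet> a t + 2 * (a t \<bullet> b t)) + b t \<bullet> b t) ((A + 2 * 0) + B)"
    by (intro has_tavg_add has_tavg_bounded_linear[OF bounded_linear_mult_right] aa ab bb
        continuous_intros cont)
  moreover have "(a t + b t) \<bullet> (a t + b t) = (a t \<bullet> a t + 2 * (a t \<bullet> b t)) + b t \<bullet> b t" for t
    by (simp add: inner_add_left inner_add_right inner_commute)
  ultimately have "tinner (\<lambda>t. a t + b t) (\<lambda>t. a t + b t) = A + B"
    unfolding tinner_def by (simp add: tavg_eqI)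
  moreover have "A \<ge> 0" "B \<ge> 0"
    using has_tavg_nonneg[OF _ _ aa] has_tavg_nonneg[OF _ _ bb] cont
    by (auto intro: continuous_intros)
  moreover have "tinner a a = A" "tinner b b = B" using aa bb unfolding tinner_def by (simp_all add: tavg_eqI)
  ultimately show "(tnorm (\<lambda>t. a t + b t))\<^sup>2 = (tnorm b)\<^sup>2 + (tnorm a)\<^sup>2"
    and "tnorm b \<le> tnorm (\<lambda>t. a t + b t)"
    by (simp_all add: tnorm_def)
qed

lemma continuous_on_matrix_vector_mult [continuous_intros]:
  fixes M :: "'a::topological_space \<Rightarrow> real^'n^'m"
  assumes "continuous_on S M" "continuous_on S w"
  shows "continuous_on S (\<lambda>t. M t *v w t)"
  unfolding matrix_vector_mult_def
  by (intro continuous_on_vec_lambda continuous_on_sum continuous_on_mult continuous_on_component assms)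

lemma continuous_on_transpose [continuous_intros]:
  fixes M :: "'a::topological_space \<Rightarrow> real^'n^'m"
  assumes "continuous_on S M"
  shows "continuous_on S (\<lambda>t. transpose (M t))"
  unfolding transpose_def
  by (intro continuous_on_vec_lambda continuous_on_component assms)

locale quasiperiodic_rotation =
  fixes \<Omega> :: "real^'d^'d" and F :: "real^'d \<Rightarrow> real \<Rightarrow> real^'d"
    and Fh :: "real^'d \<Rightarrow> (nat \<Rightarrow> real) \<Rightarrow> real^'d" and n :: nat and \<nu> :: "nat \<Rightarrow> real"
  assumes skew: "transpose \<Omega> = - \<Omega>"
    and F_bounded: "bounded (range (\<lambda>(y, t). F y t))"
    and F_cont: "continuous_on UNIV (\<lambda>(y, t). F y t)"
    and Fh_cont: "continuous_on UNIV (\<lambda>(y, \<theta>). Fh y \<theta>)"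
    and Fh_periodic: "\<forall>y \<theta> i. i < n \<longrightarrow> Fh y (\<theta>(i := \<theta> i + 1)) = Fh y \<theta>"
    and F_eq: "\<forall>y t. F y t = Fh y (\<lambda>i. if i < n then \<nu> i * t else 0)"
begin

lemma continuous_on_orbit: "continuous_on UNIV (\<lambda>t. F (mexp \<Omega> t *v x) t)"
proof -
  have "continuous_on UNIV (\<lambda>t. (\<lambda>(y, t). F y t) (mexp \<Omega> t *v x, t))"
    by (rule continuous_on_compose2[OF F_cont])
      (auto intro!: continuous_intros continuous_on_mexp[OF skew])
  then show ?thesis by simp
qed

lemma has_tavg_rotating_frame:
  fixes \<phi> :: "(real^'d^'d) \<times> (real^'d) \<Rightarrow> 'b::euclidean_space"
  assumes "continuous_on UNIV \<phi>"
  shows "\<exists>c. has_tavg (\<lambda>t. \<phi> (mexp \<Omega> t, F (mexp \<Omega> t *v x) t)) c"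
proof (rule has_tavg_continuous_image[OF _ _ _ assms])
  show "almost_periodic (\<lambda>t. (mexp \<Omega> t, F (mexp \<Omega> t *v x) t))"
    using mexp_add[OF skew] orthogonal_matrix_mexp[OF skew] Fh_cont Fh_periodic F_eq
    by (rule almost_periodic_orthogonal_frame)
  show "continuous_on UNIV (\<lambda>t. (mexp \<Omega> t, F (mexp \<Omega> t *v x) t))"
    by (intro continuous_on_Pair continuous_on_mexp[OF skew] continuous_on_orbit)
  have "range (\<lambda>t. (mexp \<Omega> t, F (mexp \<Omega> t *v x) t)) \<subseteq> range (mexp \<Omega>) \<times> range (\<lambda>(y, t). F y t)"
    by auto
  then show "bounded (range (\<lambda>t. (mexp \<Omega> t, F (mexp \<Omega> t *v x) t)))"
    using bounded_Times[OF bounded_range_orthogonal_matrix[OF orthogonal_matrix_mexp[OF skew]]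
        F_bounded] by (rule bounded_subset[rotated])
qed

lemma calF_eq: "calF \<Omega> F x t = transpose (mexp \<Omega> t) *v F (mexp \<Omega> t *v x) t"
  by (simp add: calF_def mexp_uminus[OF skew])

lemma continuous_on_calF: "continuous_on UNIV (calF \<Omega> F x)"
  unfolding calF_eq[abs_def]
  by (intro continuous_intros continuous_on_mexp[OF skew] continuous_on_orbit)

lemma has_tavg_avgC: "has_tavg (\<lambda>t. F (mexp \<Omega> t *v x) t) (avgC \<Omega> F x)"
proof -
  have "continuous_on UNIV (snd :: (real^'d^'d) \<times> (real^'d) \<Rightarrow> real^'d)"
    by (intro continuous_intros)
  from has_tavg_rotating_frame[OF this] obtain c where "has_tavg (\<lambda>t. F (mexp \<Omega> t *v x) t) c"
    by auto
  then show ?thesis by (simp add: avgC_def tavg_eqI)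
qed

lemma has_tavg_calF: "has_tavg (calF \<Omega> F x) (tavg (calF \<Omega> F x))"
proof -
  have "continuous_on UNIV (\<lambda>p :: (real^'d^'d) \<times> (real^'d). transpose (fst p) *v snd p)"
    by (intro continuous_intros)
  from has_tavg_rotating_frame[OF this]
  obtain c where "has_tavg (\<lambda>t. transpose (mexp \<Omega> t) *v F (mexp \<Omega> t *v x) t) c"
    by auto
  then show ?thesis by (simp add: calF_eq[abs_def] tavg_eqI)
qed

abbreviation drift :: "real^'d \<Rightarrow> real \<Rightarrow> real^'d" where
  "drift x t \<equiv> mexp \<Omega> (- t) *v (\<Omega> *v Pfun \<Omega> F x)"

lemma continuous_on_drift: "continuous_on UNIV (drift x)"
  by (intro continuous_intros continuous_on_compose2[OF continuous_on_mexp[OF skew]]) auto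

lemma calG_eq: "calG \<Omega> F x t = calF \<Omega> F x t - drift x t"
  by (simp add: calG_def calF_def matrix_vector_mult_diff_distrib)

lemma DcalF_minus_DcalG: "DcalF \<Omega> F x t - DcalG \<Omega> F x t = drift x t"
proof -
  have "has_tavg (\<lambda>t. calF \<Omega> F x t - drift x t) (tavg (calF \<Omega> F x) - 0)"
    by (intro has_tavg_diff continuous_on_calF continuous_on_drift has_tavg_calF
        has_tavg_mexp_uminus_range[OF skew])
  then have "tavg (calG \<Omega> F x) = tavg (calF \<Omega> F x)"
    by (simp add: calG_eq[abs_def] tavg_eqI)
  then show ?thesis by (simp add: DcalF_def DcalG_def calG_eq)
qed

lemma has_tavg_inner_drift_DcalG: "has_tavg (\<lambda>t. drift x t \<bullet> DcalG \<Omega> F x t) 0"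
proof -
  define v where "v = \<Omega> *v Pfun \<Omega> F x"
  define c where "c = tavg (calF \<Omega> F x)"
  have orth: "orthogonal_matrix (mexp \<Omega> (- t))" for t by (rule orthogonal_matrix_mexp[OF skew])
  have "DcalG \<Omega> F x t = mexp \<Omega> (- t) *v (F (mexp \<Omega> t *v x) t - v) - c" for t
    using DcalF_minus_DcalG[of x t]
    by (simp add: DcalF_def calF_def c_def v_def matrix_vector_mult_diff_distrib algebra_simps)
  then have "drift x t \<bullet> DcalG \<Omega> F x t = (v \<bullet> F (mexp \<Omega> t *v x) t - v \<bullet> v) - drift x t \<bullet> c" for t
    by (simp add: v_def inner_diff_right inner_orthogonal_matrix_vector_mult[OF orth])
  moreover have "has_tavg (\<lambda>t. (v \<bullet> F (mexp \<Omega> t *v x) t - v \<bullet> v) - drift x t \<bullet> c)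
      ((v \<bullet> avgC \<Omega> F x - v \<bullet> v) - 0 \<bullet> c)"
    by (intro has_tavg_diff has_tavg_const has_tavg_avgC continuous_intros continuous_on_orbit
        continuous_on_drift has_tavg_mexp_uminus_range[OF skew]
        has_tavg_bounded_linear[OF bounded_linear_inner_right]
        has_tavg_bounded_linear[OF bounded_linear_inner_left])
  moreover have "v \<bullet> avgC \<Omega> F x = v \<bullet> v"
    unfolding v_def Pfun_def by (rule skew_omega_hat_inv_projection[OF skew])
  ultimately show ?thesis by simp
qed

lemma has_tavg_inner_drift: "has_tavg (\<lambda>t. drift x t \<bullet> drift x t) ((\<Omega> *v Pfun \<Omega> F x) \<bullet> (\<Omega> *v Pfun \<Omega> F x))"
  using has_tavg_const
  by (simp add: inner_orthogonal_matrix_vector_mult[OF orthogonal_matrix_mexp[OF skew]])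

lemma DcalG_eq:
  "DcalG \<Omega> F x t = transpose (mexp \<Omega> t) *v (F (mexp \<Omega> t *v x) t - \<Omega> *v Pfun \<Omega> F x) - tavg (calG \<Omega> F x)"
  by (simp add: DcalG_def calG_def mexp_uminus[OF skew])

lemma continuous_on_DcalG: "continuous_on UNIV (DcalG \<Omega> F x)"
  unfolding DcalG_eq[abs_def]
  by (intro continuous_intros continuous_on_mexp[OF skew] continuous_on_orbit)

lemma has_tavg_inner_DcalG: "\<exists>B. has_tavg (\<lambda>t. DcalG \<Omega> F x t \<bullet> DcalG \<Omega> F x t) B"
proof -
  define g where "g p = transpose (fst p) *v (snd p - \<Omega> *v Pfun \<Omega> F x) - tavg (calG \<Omega> F x)"
    for p :: "(real^'d^'d) \<times> (real^'d)"
  have "continuous_on UNIV (\<lambda>p. g p \<bullet> g p)" unfolding g_def by (intro continuous_intros)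
  from has_tavg_rotating_frame[OF this] show ?thesis
    by (simp add: g_def DcalG_eq)
qed

end

theorem theorem1:
  fixes \<Omega> :: "real^'d^'d"
    and F :: "real^'d \<Rightarrow> real \<Rightarrow> real^'d"
    and x :: "real^'d"
  assumes skew: "transpose \<Omega> = - \<Omega>"
    and F_bounded: "bounded (range (\<lambda>(y, t). F y t))"
    and F_cont: "continuous_on UNIV (\<lambda>(y, t). F y t)"
    and F_deriv: "\<exists>DF :: real^'d \<Rightarrow> real \<Rightarrow> ((real^'d) \<Rightarrow>\<^sub>L (real^'d)).
        (\<forall>y t. ((\<lambda>z. F z t) has_derivative blinfun_apply (DF y t)) (at y)) \<and>
        continuous_on UNIV (\<lambda>(y, t). DF y t) \<and>
        bounded (range (\<lambda>(y, t). DF y t))"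
    and F_qp: "\<exists>(n::nat) (\<nu>::nat \<Rightarrow> real) (Fh :: real^'d \<Rightarrow> (nat \<Rightarrow> real) \<Rightarrow> real^'d).
        continuous_on UNIV (\<lambda>(y, \<theta>). Fh y \<theta>) \<and>
        (\<forall>y \<theta> i. i < n \<longrightarrow> Fh y (\<theta>(i := \<theta> i + 1)) = Fh y \<theta>) \<and>
        (\<forall>y t. F y t = Fh y (\<lambda>i. if i < n then \<nu> i * t else 0))"
  shows "tinner (\<lambda>t. DcalF \<Omega> F x t - DcalG \<Omega> F x t) (DcalG \<Omega> F x) = 0 \<and>
         (tnorm (DcalF \<Omega> F x))\<^sup>2 = (tnorm (DcalG \<Omega> F x))\<^sup>2 + (tnorm (\<lambda>t. DcalF \<Omega> F x t - DcalG \<Omega> F x t))\<^sup>2 \<and>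
         tnorm (DcalG \<Omega> F x) \<le> tnorm (DcalF \<Omega> F x)"
proof -
  obtain n \<nu> Fh where "quasiperiodic_rotation \<Omega> F Fh n \<nu>"
    using F_qp skew F_bounded F_cont unfolding quasiperiodic_rotation_def by blast
  then interpret quasiperiodic_rotation \<Omega> F Fh n \<nu> .
  have drift: "(\<lambda>t. DcalF \<Omega> F x t - DcalG \<Omega> F x t) = drift x"
    by (simp add: fun_eq_iff DcalF_minus_DcalG)
  have DcalF: "DcalF \<Omega> F x = (\<lambda>t. drift x t + DcalG \<Omega> F x t)"
    using drift by (simp add: fun_eq_iff) (metis diff_add_cancel)
  obtain B where "has_tavg (\<lambda>t. DcalG \<Omega> F x t \<bullet> DcalG \<Omega> F x t) B"
    using has_tavg_inner_DcalG by blast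
  note pythagoras = tnorm_pythagoras[OF continuous_on_drift continuous_on_DcalG
      has_tavg_inner_drift_DcalG has_tavg_inner_drift this]
  show ?thesis
    unfolding drift DcalF using pythagoras
    by (simp add: tinner_def tavg_eqI[OF has_tavg_inner_drift_DcalG])
qed

end
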